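(* If $u>1$ and $v>1$ are odd integers, then there exists an optimal $(4u\times 8v,\{4,5\},1)$-BDP, i.e. an optimal balanced $(Z_{4u}\times Z_{8v},\{4,5\},1)$ difference packing.
   Context: Let $G$ be a finite additive group and $K$ a set of positive integers. For $C\subseteq G$, $\Delta C$ denotes the multiset of all differences $x-y$ with $(x,y)$ an ordered pair of distinct elements of $C$. A $(G,K,1)$ difference packing is a set $\mathcal B$ of subsets of $G$ (blocks), each of size in $K$, such that the multiset $\bigcup_{B\in\mathcal B}\Delta B$ contains every element of $G$ at most once. It is balanced (a $(G,K,1)$-BDP) if the number of blocks of size $k$ is the same for every $k\in K$. Let $I(G)$ be the set consisting of the identity and all involutions of $G$. A $(G,K,1)$-BDP is optimal if for every $k\in K$ its number of blocks of size $k$ equals $\left\lfloor |G\setminus I(G)| / \sum_{k'\in K}(k'^2-k')\right\rfloor$. A $(u\times v,K,1)$-BDP means a $(Z_u\times Z_v,K,1)$-BDP. *)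

theory Defs
  imports "HOL-Algebra.Elementary_Groups" "HOL-Library.Multiset"
begin

text \<open>Groups are written multiplicatively, as everywhere in HOL-Algebra: the difference
  \<open>x - y\<close> of an additive group is \<open>x \<otimes> inv y\<close>.\<close>

definition differences :: "('a, 'b) monoid_scheme \<Rightarrow> 'a set \<Rightarrow> 'a multiset" where
  "differences G C =
     image_mset (\<lambda>(x, y). x \<otimes>\<^bsub>G\<^esub> inv\<^bsub>G\<^esub> y) (mset_set {(x, y). x \<in> C \<and> y \<in> C \<and> x \<noteq> y})"

definition one_or_involution :: "('a, 'b) monoid_scheme \<Rightarrow> 'a set" where
  "one_or_involution G =
     {\<one>\<^bsub>G\<^esub>} \<union> {x \<in> carrier G. x \<noteq> \<one>\<^bsub>G\<^esub> \<and> x \<otimes>\<^bsub>G\<^esub> x = \<one>\<^bsub>G\<^esub>}"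

text \<open>The multiset union of the difference lists adds multiplicities, hence the sum
  over \<open>\<B>\<close>, which is a finite set since \<open>G\<close> is finite.\<close>

locale difference_packing = group G
  for G (structure) +
  fixes K :: "nat set" and \<B> :: "'a set set"
  assumes finite_carrier: "finite (carrier G)"
    and sizes_pos: "\<And>k. k \<in> K \<Longrightarrow> k > 0"
    and block_subset: "\<And>B. B \<in> \<B> \<Longrightarrow> B \<subseteq> carrier G"
    and block_size: "\<And>B. B \<in> \<B> \<Longrightarrow> card B \<in> K"
    and differences_le_1: "\<And>g. g \<in> carrier G \<Longrightarrow> count (\<Sum>B\<in>\<B>. differences G B) g \<le> 1"

locale balanced_difference_packing = difference_packing +
  assumes balanced:
    "\<And>k l. k \<in> K \<Longrightarrow> l \<in> K \<Longrightarrow> card {B \<in> \<B>. card B = k} = card {B \<in> \<B>. card B = l}"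

locale optimal_balanced_difference_packing = balanced_difference_packing +
  assumes optimal:
    "\<And>k. k \<in> K \<Longrightarrow> card {B \<in> \<B>. card B = k} =
       card (carrier G - one_or_involution G) div (\<Sum>l\<in>K. l\<^sup>2 - l)"

end

theory Submission
  imports Defs "HOL-Library.Product_Plus" "HOL-Number_Theory.Euler_Criterion"
begin

text \<open>For odd \<open>u\<close> and \<open>v\<close> the group is \<open>Z\<^sub>4 \<times> Z\<^sub>8 \<times> Z\<^sub>u \<times> Z\<^sub>v\<close>, and \<open>u v - 1\<close> blocks of each size are
  needed. A packing that avoids the differences in a subgroup is completed by an optimal packing of
  that subgroup, and it is lifted along a quotient map whose kernel has a difference matrix with
  five rows. The multiples of \<open>0, 1, 2, 3, 4\<close> form such a matrix for kernels of order prime to 6,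
  and \<open>Z\<^sub>3 \<times> Z\<^sub>3\<close> and \<open>Z\<^sub>2\<^sub>7\<close> have such matrices too. This reduces the theorem to relative packings of
  small index: finitely many for the prime 3, and one for each prime \<open>p \<ge> 5\<close> over \<open>Z\<^sub>4 \<times> Z\<^sub>8\<close> and over
  \<open>Z\<^sub>4 \<times> Z\<^sub>8 \<times> Z\<^sub>3\<close>. The latter come from templates whose second coordinates are multiplied by
  quadratic residues. For \<open>p \<equiv> 3 (mod 4)\<close> the rows of the template form a transitive subtournament of
  the Paley tournament; for \<open>p \<equiv> 1 (mod 4)\<close> they are combinations of \<open>1\<close> and a suitable nonresidue.\<close>

text \<open>One block of each size contributes 12 + 20 = 32 differences, and 32 is the order of
  \<open>Z_4 x Z_8\<close>. Hence a relative packing has no slack: every element outside the hole is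
  a difference exactly once. Slack remains only in the optimal packings of orders 1 and 3 at which
  the recursion ends; in order 1 there are no blocks at all. The obstacle is the prime 3. The points
  of a block are distinct modulo the hole, so the index of a hole is at least 5, and index 3 is
  impossible. A kernel \<open>Z_3\<close> is impossible too, since a difference matrix over it has
  at most three rows. So the 3-part is removed in portions of index 9 or 81, with kernels
  \<open>Z_(3^a) x Z_(3^b)\<close> where a and b agree modulo 3; these are what
  \<open>Z_3 x Z_3\<close> and \<open>Z_27\<close> can build. If a single factor \<open>Z_3\<close>
  is left over, it never enters a kernel but is carried along in the base, which is why every prime
  p >= 5 is also treated over \<open>Z_4 x Z_8 x Z_3\<close>.\<close>

section \<open>Packings in quotients of abelian groups\<close>

text \<open>A packing in the quotient by a subgroup \<open>L\<close> is a family of lists of representatives;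
  the set \<open>X\<close> constrains the differences.\<close>

definition packs :: "'a::ab_group_add set \<Rightarrow> 'a set \<Rightarrow> ('b \<Rightarrow> 'a list) \<Rightarrow> 'b set \<Rightarrow> bool" where
  "packs L X f I \<longleftrightarrow> finite I \<and> (\<forall>a\<in>I. length (f a) \<in> {4, 5}) \<and>
     (\<forall>a\<in>I. \<forall>i<length (f a). \<forall>j<length (f a). i \<noteq> j \<longrightarrow> f a ! i - f a ! j \<in> X) \<and>
     (\<forall>a\<in>I. \<forall>b\<in>I. \<forall>i<length (f a). \<forall>j<length (f a). i \<noteq> j \<longrightarrow>
        (\<forall>k<length (f b). \<forall>l<length (f b). k \<noteq> l \<longrightarrow>
          (f a ! i - f a ! j) - (f b ! k - f b ! l) \<in> L \<longrightarrow> a = b \<and> i = k \<and> j = l))"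

definition packable :: "'a::ab_group_add set \<Rightarrow> 'a set \<Rightarrow> nat \<Rightarrow> bool" where
  "packable L X n \<longleftrightarrow> (\<exists>F. packs L X (\<lambda>B. B) F \<and>
     card {B \<in> F. length B = 4} = n \<and> card {B \<in> F. length B = 5} = n)"

lemma packsI:
  assumes "finite I" and "\<And>a. a \<in> I \<Longrightarrow> length (f a) \<in> {4, 5}"
    and "\<And>a i j. a \<in> I \<Longrightarrow> i < length (f a) \<Longrightarrow> j < length (f a) \<Longrightarrow> i \<noteq> j \<Longrightarrow> f a ! i - f a ! j \<in> X"
    and "\<And>a b i j k l. a \<in> I \<Longrightarrow> b \<in> I \<Longrightarrow> i < length (f a) \<Longrightarrow> j < length (f a) \<Longrightarrow> i \<noteq> j \<Longrightarrow>
      k < length (f b) \<Longrightarrow> l < length (f b) \<Longrightarrow> k \<noteq> l \<Longrightarrow>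
      (f a ! i - f a ! j) - (f b ! k - f b ! l) \<in> L \<Longrightarrow> a = b \<and> i = k \<and> j = l"
  shows "packs L X f I"
  unfolding packs_def
  apply (rule conjI, rule assms(1))
  apply (rule conjI, intro ballI, erule assms(2))
  apply (rule conjI, intro ballI allI impI, rule assms(3), assumption+)
  apply (intro ballI allI impI, rule assms(4), assumption+)
  done

lemma packs_finite: "packs L X f I \<Longrightarrow> finite I"
  unfolding packs_def by (elim conjE)

lemma packs_length: "packs L X f I \<Longrightarrow> a \<in> I \<Longrightarrow> length (f a) \<in> {4, 5}"
  unfolding packs_def by (elim conjE) (erule bspec)

lemma packs_diff_in:
  "packs L X f I \<Longrightarrow> a \<in> I \<Longrightarrow> i < length (f a) \<Longrightarrow> j < length (f a) \<Longrightarrow> i \<noteq> j \<Longrightarrow>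
     f a ! i - f a ! j \<in> X"
  unfolding packs_def by meson

lemma packs_diff_inj:
  "packs L X f I \<Longrightarrow> a \<in> I \<Longrightarrow> b \<in> I \<Longrightarrow> i < length (f a) \<Longrightarrow> j < length (f a) \<Longrightarrow> i \<noteq> j \<Longrightarrow>
     k < length (f b) \<Longrightarrow> l < length (f b) \<Longrightarrow> k \<noteq> l \<Longrightarrow>
     (f a ! i - f a ! j) - (f b ! k - f b ! l) \<in> L \<Longrightarrow> a = b \<and> i = k \<and> j = l"
  unfolding packs_def by meson

text \<open>A block has at least two entries, and the difference of its first two already determines
  the index.\<close>

lemma packs_inj_on:
  assumes "packs L X f I" and "0 \<in> L"
  shows "inj_on f I"
proof (rule inj_onI)
  fix a b assume ab: "a \<in> I" "b \<in> I" "f a = f b"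
  have "length (f a) \<in> {4, 5}" using packs_length[OF assms(1) ab(1)] .
  then have *: "0 < length (f a)" "1 < length (f a)" by auto
  have **: "f a ! 0 - f a ! 1 - (f b ! 0 - f b ! 1) \<in> L" by (simp add: ab(3) assms(2))
  show "a = b"
    using packs_diff_inj[OF assms(1) ab(1,2) * zero_neq_one *[unfolded ab(3)] zero_neq_one **] by (rule conjunct1)
qed

lemma packableI:
  assumes p: "packs L X f I" and "0 \<in> L"
    and c4: "card {a \<in> I. length (f a) = 4} = n" and c5: "card {a \<in> I. length (f a) = 5} = n"
  shows "packable L X n"
proof -
  have inj: "inj_on f I" by (rule packs_inj_on) fact+
  have "packs L X (\<lambda>B. B) (f ` I)"
  proof (rule packsI)
    show "finite (f ` I)" using packs_finite[OF p] by (rule finite_imageI)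
  next
    fix B assume "B \<in> f ` I" then show "length B \<in> {4, 5}" using packs_length[OF p] by blast
  next
    fix B i j assume B: "B \<in> f ` I" and ij: "i < length B" "j < length B" "i \<noteq> j"
    obtain a where a: "a \<in> I" "B = f a" using B by blast
    show "B ! i - B ! j \<in> X" unfolding a(2) by (rule packs_diff_in[OF p a(1) ij[unfolded a(2)]])
  next
    fix B C i j k l assume BC: "B \<in> f ` I" "C \<in> f ` I" and *: "i < length B" "j < length B" "i \<noteq> j"
      "k < length C" "l < length C" "k \<noteq> l" "B ! i - B ! j - (C ! k - C ! l) \<in> L"
    obtain a b where ab: "a \<in> I" "B = f a" "b \<in> I" "C = f b" using BC by blast
    have "a = b \<and> i = k \<and> j = l" using packs_diff_inj[OF p ab(1,3) *[unfolded ab(2,4)]] .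
    then show "B = C \<and> i = k \<and> j = l" unfolding ab by blast
  qed
  moreover have "card {B \<in> f ` I. length B = m} = card {a \<in> I. length (f a) = m}" for m
  proof -
    have "{B \<in> f ` I. length B = m} = f ` {a \<in> I. length (f a) = m}" by auto
    then show ?thesis by (simp add: card_image inj_on_subset[OF inj])
  qed
  ultimately show ?thesis
    unfolding packable_def by (intro exI[of _ "f ` I"] conjI) (simp_all only: c4 c5)
qed

lemma packableE:
  assumes "packable L X n"
  obtains F where "packs L X (\<lambda>B. B) F" "card {B \<in> F. length B = 4} = n" "card {B \<in> F. length B = 5} = n"
  using assms unfolding packable_def by (elim exE conjE)

lemma packable_0: "packable L X 0"
  unfolding packable_def by (intro exI[of _ "{}"]) (simp add: packs_def)

text \<open>\<open>L\<close> is any set containing 0, not necessarily a subgroup, so separation is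
  required in both orders.\<close>

lemma packable_Un:
  assumes A: "packable L X m" and B: "packable L Y n"
    and sep: "\<And>x y. x \<in> X \<Longrightarrow> y \<in> Y \<Longrightarrow> x - y \<notin> L \<and> y - x \<notin> L"
    and "0 \<in> L"
  shows "packable L (X \<union> Y) (m + n)"
proof -
  obtain F where F: "packs L X (\<lambda>B. B) F" "card {B \<in> F. length B = 4} = m" "card {B \<in> F. length B = 5} = m"
    using packableE[OF A] .
  obtain G where G: "packs L Y (\<lambda>B. B) G" "card {B \<in> G. length B = 4} = n" "card {B \<in> G. length B = 5} = n"
    using packableE[OF B] .
  have disj: False if "x \<in> F" "x \<in> G" for x
  proof -
    have "length x \<in> {4, 5}" using packs_length[OF F(1) that(1)] .
    then have "0 < length x" "1 < length x" by auto
    then have "x ! 0 - x ! 1 \<in> X" "x ! 0 - x ! 1 \<in> Y"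
      using packs_diff_in[OF F(1) that(1)] packs_diff_in[OF G(1) that(2)] by auto
    then show False using sep[of "x ! 0 - x ! 1" "x ! 0 - x ! 1"] \<open>0 \<in> L\<close> by simp
  qed
  have "packs L (X \<union> Y) (\<lambda>B. B) (F \<union> G)"
  proof (rule packsI)
    show "finite (F \<union> G)" using packs_finite[OF F(1)] packs_finite[OF G(1)] by simp
  next
    fix a assume "a \<in> F \<union> G" then show "length a \<in> {4, 5}"
      using packs_length[OF F(1)] packs_length[OF G(1)] by blast
  next
    fix a i j assume "a \<in> F \<union> G" "i < length a" "j < length a" "i \<noteq> j"
    then show "a ! i - a ! j \<in> X \<union> Y" using packs_diff_in[OF F(1)] packs_diff_in[OF G(1)] by blast
  next
    fix a b i j k l assume *: "a \<in> F \<union> G" "b \<in> F \<union> G" "i < length a" "j < length a" "i \<noteq> j"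
      "k < length b" "l < length b" "k \<noteq> l" "a ! i - a ! j - (b ! k - b ! l) \<in> L"
    consider "a \<in> F" "b \<in> F" | "a \<in> G" "b \<in> G" | "a \<in> F" "b \<in> G" | "a \<in> G" "b \<in> F"
      using * by blast
    then show "a = b \<and> i = k \<and> j = l"
    proof cases
      case 1 show ?thesis by (rule packs_diff_inj[OF F(1) 1 *(3-9)])
    next
      case 2 show ?thesis by (rule packs_diff_inj[OF G(1) 2 *(3-9)])
    next
      case 3
      then show ?thesis using packs_diff_in[OF F(1) 3(1) *(3-5)] packs_diff_in[OF G(1) 3(2) *(6-8)] sep *(9)
        by blast
    next
      case 4
      then show ?thesis using packs_diff_in[OF G(1) 4(1) *(3-5)] packs_diff_in[OF F(1) 4(2) *(6-8)] sep *(9)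
        by blast
    qed
  qed
  moreover have "card {B \<in> F \<union> G. length B = k} = card {B \<in> F. length B = k} + card {B \<in> G. length B = k}" for k
  proof -
    have "{B \<in> F \<union> G. length B = k} = {B \<in> F. length B = k} \<union> {B \<in> G. length B = k}" by auto
    then show ?thesis using disj packs_finite[OF F(1)] packs_finite[OF G(1)]
      by (auto intro!: card_Un_disjoint)
  qed
  ultimately show ?thesis
    unfolding packable_def by (intro exI[of _ "F \<union> G"] conjI) (simp_all only: F G)
qed

text \<open>Serves for isomorphisms, for embedding a subgroup as a hole and for Chinese remaindering
  alike: injectivity of the induced map means that \<open>h\<close> reflects \<open>L'\<close> into
  \<open>L\<close>.\<close>

lemma packable_hom:
  assumes P: "packable L X n"
    and hom: "\<And>x y. h (x - y) = h x - h y"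
    and inj: "\<And>x. h x \<in> L' \<Longrightarrow> x \<in> L" and X: "\<And>x. x \<in> X \<Longrightarrow> h x \<in> X'" and "0 \<in> L'"
  shows "packable L' X' n"
proof -
  obtain F where F: "packs L X (\<lambda>B. B) F" "card {B \<in> F. length B = 4} = n" "card {B \<in> F. length B = 5} = n"
    using packableE[OF P] .
  show ?thesis
  proof (rule packableI)
    show "packs L' X' (map h) F"
    proof (rule packsI)
      show "finite F" using packs_finite[OF F(1)] .
    next
      fix a assume "a \<in> F" then show "length (map h a) \<in> {4, 5}" using packs_length[OF F(1)] by simp
    next
      fix a i j assume "a \<in> F" "i < length (map h a)" "j < length (map h a)" "i \<noteq> j"
      then show "map h a ! i - map h a ! j \<in> X'"
        using packs_diff_in[OF F(1), of a i j] X hom by (simp flip: hom)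
    next
      fix a b i j k l assume *: "a \<in> F" "b \<in> F" "i < length (map h a)" "j < length (map h a)" "i \<noteq> j"
        "k < length (map h b)" "l < length (map h b)" "k \<noteq> l"
        "map h a ! i - map h a ! j - (map h b ! k - map h b ! l) \<in> L'"
      then show "a = b \<and> i = k \<and> j = l"
        by (intro packs_diff_inj[OF F(1), of a b i j k l]) (auto intro!: inj simp: hom)
    qed
  qed (use F \<open>0 \<in> L'\<close> in simp_all)
qed

section \<open>Difference matrices\<close>

text \<open>The lists are the columns. Any two rows have distinct differences modulo
  \<open>L\<close>; when there are as many columns as group elements, this is a difference matrix of
  index 1 with five rows.\<close>

definition dmatrix :: "'a::ab_group_add set \<Rightarrow> 'a list set \<Rightarrow> bool" where
  "dmatrix L D \<longleftrightarrow> finite D \<and> (\<forall>c\<in>D. length c = 5) \<and>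
     (\<forall>c\<in>D. \<forall>d\<in>D. \<forall>i<5. \<forall>j<5. i \<noteq> j \<longrightarrow> (c ! i - c ! j) - (d ! i - d ! j) \<in> L \<longrightarrow> c = d)"

text \<open>Modulo \<open>L'\<close> a difference determines the block and the two positions. With
  these known, the difference of two matrix rows modulo \<open>L\<close> determines the column.
  Since \<open>map2\<close> truncates, blocks of size 4 use the first four rows only.\<close>

lemma packable_lift:
  assumes P: "packable L' X n" and D: "dmatrix L D" "\<And>c. c \<in> D \<Longrightarrow> set c \<subseteq> L'"
    and sub: "L \<subseteq> L'" "\<And>x y. x \<in> L' \<Longrightarrow> y \<in> L' \<Longrightarrow> x - y \<in> L'" "0 \<in> L"
    and X: "\<And>x y. x \<in> X \<Longrightarrow> y \<in> L' \<Longrightarrow> x + y \<in> X"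
  shows "packable L X (n * card D)"
proof -
  obtain F where F: "packs L' X (\<lambda>B. B) F" "card {B \<in> F. length B = 4} = n" "card {B \<in> F. length B = 5} = n"
    using packableE[OF P] .
  define f where "f = (\<lambda>(B, c). map2 (+) B c :: 'a list)"
  have len: "length (f (B, c)) = length B" if "B \<in> F" "c \<in> D" for B c
    using packs_length[OF F(1) that(1)] D(1) that(2) by (auto simp: f_def dmatrix_def)
  have nth: "f (B, c) ! i = B ! i + c ! i" if "B \<in> F" "c \<in> D" "i < length B" for B c i
    using packs_length[OF F(1) that(1)] D(1) that(2,3) by (auto simp: f_def dmatrix_def)
  have i5: "i < 5" if "B \<in> F" "i < length B" for B i
    using packs_length[OF F(1) that(1)] that(2) by auto
  have inL: "c ! i \<in> L'" if "c \<in> D" "i < 5" for c i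
  proof -
    have "length c = 5" using D(1) that(1) unfolding dmatrix_def by blast
    then show ?thesis using D(2)[OF that(1)] nth_mem[of i c] that(2) by auto
  qed
  have diff: "f (B, c) ! i - f (B, c) ! j = (B ! i - B ! j) + (c ! i - c ! j)"
    if "B \<in> F" "c \<in> D" "i < length B" "j < length B" for B c i j
    using that by (simp add: nth)
  have "packs L X f (F \<times> D)"
  proof (rule packsI)
    show "finite (F \<times> D)" using packs_finite[OF F(1)] D(1) by (simp add: dmatrix_def)
  next
    fix a assume "a \<in> F \<times> D" then show "length (f a) \<in> {4, 5}"
      using len packs_length[OF F(1)] by (cases a) auto
  next
    fix a i j assume *: "a \<in> F \<times> D" "i < length (f a)" "j < length (f a)" "i \<noteq> j"
    obtain B c where a: "a = (B, c)" "B \<in> F" "c \<in> D" using * by auto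
    have ij: "i < length B" "j < length B" using * a len by auto
    have "B ! i - B ! j \<in> X" by (rule packs_diff_in[OF F(1) a(2) ij *(4)])
    moreover have "c ! i - c ! j \<in> L'" using sub(2) inL a i5 ij by blast
    ultimately show "f a ! i - f a ! j \<in> X" using X diff a ij by simp
  next
    fix a b i j k l assume *: "a \<in> F \<times> D" "b \<in> F \<times> D" "i < length (f a)" "j < length (f a)" "i \<noteq> j"
      "k < length (f b)" "l < length (f b)" "k \<noteq> l" "f a ! i - f a ! j - (f b ! k - f b ! l) \<in> L"
    obtain B c where a: "a = (B, c)" "B \<in> F" "c \<in> D" using * by auto
    obtain C d where b: "b = (C, d)" "C \<in> F" "d \<in> D" using * by auto
    have ij: "i < length B" "j < length B" using * a len by auto
    have kl: "k < length C" "l < length C" using * b len by auto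
    have e: "f a ! i - f a ! j - (f b ! k - f b ! l)
        = ((B ! i - B ! j) - (C ! k - C ! l)) - ((d ! k - d ! l) - (c ! i - c ! j))"
      unfolding a(1) b(1) diff[OF a(2,3) ij] diff[OF b(2,3) kl] by (simp add: algebra_simps)
    have cd: "(d ! k - d ! l) - (c ! i - c ! j) \<in> L'"
      using sub(2) inL a b i5 ij kl by meson
    have "0 - ((d ! k - d ! l) - (c ! i - c ! j)) \<in> L'" using cd sub by blast
    then have "((B ! i - B ! j) - (C ! k - C ! l)) \<in> L'"
      using sub(2)[of "f a ! i - f a ! j - (f b ! k - f b ! l)" "0 - ((d ! k - d ! l) - (c ! i - c ! j))"]
        *(9) sub(1) e by auto
    then have BC: "B = C" "i = k" "j = l"
      using packs_diff_inj[OF F(1) a(2) b(2) ij *(5) kl *(8)] by auto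
    have "(c ! i - c ! j) - (d ! i - d ! j) \<in> L" using *(9) e BC by simp
    then have "c = d" using D(1) a(3) b(3) i5[OF a(2)] ij *(5) unfolding dmatrix_def by blast
    then show "a = b \<and> i = k \<and> j = l" using a b BC by simp
  qed
  moreover have "card {a \<in> F \<times> D. length (f a) = m} = card {B \<in> F. length B = m} * card D" for m
  proof -
    have "{a \<in> F \<times> D. length (f a) = m} = {B \<in> F. length B = m} \<times> D" using len by auto
    then show ?thesis by (simp add: card_cartesian_product)
  qed
  ultimately show ?thesis
    by (intro packableI[where f = f and I = "F \<times> D"] sub(3)) (simp_all only: F)
qed

section \<open>The groups \<open>Z\<^sub>4 \<times> Z\<^sub>8 \<times> Z\<^sub>u \<times> Z\<^sub>v\<close>\<close>

type_synonym point = "(int \<times> int) \<times> (int \<times> int)"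

definition modlat :: "nat \<Rightarrow> nat \<Rightarrow> (int \<times> int) set" where
  "modlat m n = {(a, b). int m dvd a \<and> int n dvd b}"

definition optimal_packable :: "nat \<Rightarrow> nat \<Rightarrow> bool" where
  "optimal_packable u v \<longleftrightarrow> packable (modlat 4 8 \<times> modlat u v) UNIV (u * v - 1)"

text \<open>The hole of a relative packing is the subgroup \<open>Z\<^sub>4 \<times> Z\<^sub>8 \<times> r Z\<^sub>u \<times> s Z\<^sub>v\<close>.\<close>

definition rel_packable :: "nat \<Rightarrow> nat \<Rightarrow> nat \<Rightarrow> nat \<Rightarrow> bool" where
  "rel_packable u v r s \<longleftrightarrow> r dvd u \<and> s dvd v \<and> packable (modlat 4 8 \<times> modlat u v)
     (- (UNIV \<times> modlat r s)) (u * v - (u div r) * (v div s))"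

definition dmatrix_exists :: "nat \<Rightarrow> nat \<Rightarrow> bool" where
  "dmatrix_exists u v \<longleftrightarrow> (\<exists>D. dmatrix (modlat u v) D \<and> card D = u * v)"

lemma mem_modlat [simp]: "(a, b) \<in> modlat m n \<longleftrightarrow> int m dvd a \<and> int n dvd b"
  by (simp add: modlat_def)

lemma modlat_0 [simp]: "0 \<in> modlat m n"
  by (simp add: zero_prod_def)

lemma modlat_diff: "x \<in> modlat m n \<Longrightarrow> y \<in> modlat m n \<Longrightarrow> x - y \<in> modlat m n"
  by (cases x; cases y) (auto intro: dvd_diff)

lemma modlat_add: "x \<in> modlat m n \<Longrightarrow> y \<in> modlat m n \<Longrightarrow> x + y \<in> modlat m n"
  by (cases x; cases y) (auto intro: dvd_add)

lemma modlat_mono: "m' dvd m \<Longrightarrow> n' dvd n \<Longrightarrow> x \<in> modlat m n \<Longrightarrow> x \<in> modlat m' n'"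
  by (cases x) (auto intro: dvd_trans[rotated])

lemma lat_0 [simp]: "0 \<in> modlat 4 8 \<times> modlat u v"
  by (simp add: zero_prod_def)

lemma optimal_packable_1: "optimal_packable 1 1"
  by (simp add: optimal_packable_def packable_0)

lemma optimal_packable_swap:
  assumes "optimal_packable u v"
  shows "optimal_packable v u"
proof -
  have "packable (modlat 4 8 \<times> modlat v u) UNIV (u * v - 1)"
    by (rule packable_hom[OF assms[unfolded optimal_packable_def],
          where h = "\<lambda>((a, b), (x, y)). ((a, b), (y, x))"]) auto
  then show ?thesis by (simp add: optimal_packable_def mult.commute)
qed

lemma rel_packable_swap:
  assumes "rel_packable u v r s"
  shows "rel_packable v u s r"
proof -
  have "packable (modlat 4 8 \<times> modlat v u) (- (UNIV \<times> modlat s r)) (u * v - (u div r) * (v div s))"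
    by (rule packable_hom[OF assms[unfolded rel_packable_def, THEN conjunct2, THEN conjunct2],
          where h = "\<lambda>((a, b), (x, y)). ((a, b), (y, x))"]) auto
  then show ?thesis using assms by (simp add: rel_packable_def mult.commute)
qed

lemma optimal_packable_fill:
  assumes R: "rel_packable u v r s" and O: "optimal_packable (u div r) (v div s)"
    and "u > 0" and "v > 0"
  shows "optimal_packable u v"
proof -
  obtain u' where u': "u = r * u'" using R by (auto simp: rel_packable_def)
  obtain v' where v': "v = s * v'" using R by (auto simp: rel_packable_def)
  have pos: "r > 0" "s > 0" "u' > 0" "v' > 0" using u' v' assms(3,4) by auto
  have div: "u div r = u'" "v div s = v'" using u' v' pos by auto
  have 1: "packable (modlat 4 8 \<times> modlat u v) (- (UNIV \<times> modlat r s)) (u * v - u' * v')"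
    using R by (simp add: rel_packable_def div)
  have "packable (modlat 4 8 \<times> modlat u' v') UNIV (u' * v' - 1)"
    using O by (simp add: optimal_packable_def div)
  then have 2: "packable (modlat 4 8 \<times> modlat u v) (UNIV \<times> modlat r s) (u' * v' - 1)"
    by (rule packable_hom[where h = "\<lambda>((a, b), (x, y)). ((a, b), (int r * x, int s * y))"])
      (use pos in \<open>auto simp: u' v' algebra_simps\<close>)
  have "packable (modlat 4 8 \<times> modlat u v) (- (UNIV \<times> modlat r s) \<union> UNIV \<times> modlat r s)
      ((u * v - u' * v') + (u' * v' - 1))"
  proof (rule packable_Un[OF 1 2])
    fix x y :: point assume *: "x \<in> - (UNIV \<times> modlat r s)" "y \<in> UNIV \<times> modlat r s"
    have m: "modlat u v \<subseteq> modlat r s" using modlat_mono[of r u s v] u' v' by auto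
    obtain x1 x2 y1 y2 where xy: "x = (x1, x2)" "y = (y1, y2)" by (cases x; cases y)
    have "x2 - y2 \<notin> modlat r s" "y2 - x2 \<notin> modlat r s"
      using modlat_add[of "x2 - y2" r s y2] modlat_diff[of y2 r s "y2 - x2"] * xy by auto
    then show "x - y \<notin> modlat 4 8 \<times> modlat u v \<and> y - x \<notin> modlat 4 8 \<times> modlat u v"
      using m xy by auto
  qed simp
  moreover have "(u * v - u' * v') + (u' * v' - 1) = u * v - 1"
  proof -
    have "u' * v' \<le> u * v" using pos by (simp add: u' v' mult_le_mono)
    moreover have "u' * v' > 0" using pos by simp
    ultimately show ?thesis by linarith
  qed
  ultimately show ?thesis
    unfolding optimal_packable_def by (simp only: Compl_partition2)
qed

lemma packable_lift_modlat:
  assumes P: "packable (modlat 4 8 \<times> modlat u v) X n" and D: "dmatrix_exists x y"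
    and X: "\<And>a b. a \<in> X \<Longrightarrow> b \<in> modlat 4 8 \<times> modlat u v \<Longrightarrow> a + b \<in> X"
    and pos: "u > 0" "v > 0"
  shows "packable (modlat 4 8 \<times> modlat (u * x) (v * y)) X (n * (x * y))"
proof -
  obtain D where D: "dmatrix (modlat x y) D" "card D = x * y"
    using D by (auto simp: dmatrix_exists_def)
  \<comment> \<open>The kernel of the reduction from \<open>Z_(u*x) x Z_(v*y)\<close> to
    \<open>Z_u x Z_v\<close> consists of the pairs (u a, v b) and is a copy of
    \<open>Z_x x Z_y\<close>.\<close>
  define h where "h = (\<lambda>(a, b). ((0, 0), (int u * a, int v * b)) :: point)"
  have hd: "h a - h b = h (a - b)" for a b
    by (cases a; cases b) (simp add: h_def algebra_simps zero_prod_def)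
  have hL: "h a \<in> modlat 4 8 \<times> modlat (u * x) (v * y) \<longleftrightarrow> a \<in> modlat x y" for a
    using pos by (cases a) (simp add: h_def)
  have inj: "inj h" using pos by (auto simp: inj_def h_def)
  have "packable (modlat 4 8 \<times> modlat (u * x) (v * y)) X (n * card (map h ` D))"
  proof (rule packable_lift[OF P _ _ _ _ _ X])
    show "dmatrix (modlat 4 8 \<times> modlat (u * x) (v * y)) (map h ` D)"
      unfolding dmatrix_def
    proof (intro conjI ballI allI impI)
      show "finite (map h ` D)" using D(1) by (simp add: dmatrix_def)
    next
      fix c assume "c \<in> map h ` D" then show "length c = 5"
        using D(1) unfolding dmatrix_def by fastforce
    next
      fix c d i j assume *: "c \<in> map h ` D" "d \<in> map h ` D" "i < (5::nat)" "j < (5::nat)" "i \<noteq> j"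
        "c ! i - c ! j - (d ! i - d ! j) \<in> modlat 4 8 \<times> modlat (u * x) (v * y)"
      obtain c' d' where cd: "c' \<in> D" "c = map h c'" "d' \<in> D" "d = map h d'" using * by blast
      have len: "length c' = 5" "length d' = 5" using D(1) cd unfolding dmatrix_def by blast+
      have "(c' ! i - c' ! j) - (d' ! i - d' ! j) \<in> modlat x y"
        using * len by (simp add: cd hd hL)
      then have "c' = d'" using D(1) cd *(3-5) unfolding dmatrix_def by blast
      then show "c = d" using cd by simp
    qed
  next
    fix c assume "c \<in> map h ` D"
    then show "set c \<subseteq> modlat 4 8 \<times> modlat u v" by (auto simp: h_def)
  next
    show "modlat 4 8 \<times> modlat (u * x) (v * y) \<subseteq> modlat 4 8 \<times> modlat u v"
      by (auto elim: dvd_mult_left)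
  next
    fix a b assume "a \<in> modlat 4 8 \<times> modlat u v" "b \<in> modlat 4 8 \<times> modlat u v"
    then show "a - b \<in> modlat 4 8 \<times> modlat u v" by (cases a; cases b) (auto intro: modlat_diff)
  qed simp_all
  moreover have "card (map h ` D) = x * y"
    using D(2) inj by (simp add: card_image inj_on_subset[OF inj_mapI[OF inj]])
  ultimately show ?thesis by simp
qed

text \<open>The hole of the lift is the full preimage of the old hole, so the same \<open>r\<close>
  and \<open>s\<close> describe it; its order grows by the factor \<open>x * y\<close>, as does the
  number of blocks.\<close>

lemma rel_packable_lift:
  assumes R: "rel_packable u v r s" and D: "dmatrix_exists x y" and pos: "u > 0" "v > 0"
  shows "rel_packable (u * x) (v * y) r s"
proof -
  obtain u' where u': "u = r * u'" using R by (auto simp: rel_packable_def)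
  obtain v' where v': "v = s * v'" using R by (auto simp: rel_packable_def)
  have "packable (modlat 4 8 \<times> modlat (u * x) (v * y)) (- (UNIV \<times> modlat r s))
      ((u * v - (u div r) * (v div s)) * (x * y))"
  proof (rule packable_lift_modlat[OF _ D _ pos])
    show "packable (modlat 4 8 \<times> modlat u v) (- (UNIV \<times> modlat r s)) (u * v - (u div r) * (v div s))"
      using R by (simp add: rel_packable_def)
  next
    fix a b :: point assume *: "a \<in> - (UNIV \<times> modlat r s)" "b \<in> modlat 4 8 \<times> modlat u v"
    obtain a1 a2 b1 b2 where ab: "a = (a1, a2)" "b = (b1, b2)" by (cases a; cases b)
    have "b2 \<in> modlat r s" using * ab modlat_mono[of r u s v b2] u' v' by auto
    then show "a + b \<in> - (UNIV \<times> modlat r s)"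
      using * ab modlat_diff[of "a2 + b2" r s b2] by auto
  qed
  moreover have "(u * v - (u div r) * (v div s)) * (x * y)
      = (u * x) * (v * y) - ((u * x) div r) * ((v * y) div s)"
    using pos u' v' by (simp add: algebra_simps)
  ultimately show ?thesis using R by (simp add: rel_packable_def)
qed

lemma dmatrix_exists_swap:
  assumes "dmatrix_exists x y"
  shows "dmatrix_exists y x"
proof -
  obtain D where D: "dmatrix (modlat x y) D" "card D = x * y"
    using assms by (auto simp: dmatrix_exists_def)
  have inj: "inj (map prod.swap)" by (intro inj_mapI) simp
  have swap: "prod.swap a \<in> modlat y x \<longleftrightarrow> a \<in> modlat x y"
    "prod.swap a - prod.swap b = prod.swap (a - b)" for a b :: "int \<times> int"
    by (cases a; cases b; auto)+
  have "dmatrix (modlat y x) (map prod.swap ` D)"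
    unfolding dmatrix_def
  proof (intro conjI ballI allI impI)
    show "finite (map prod.swap ` D)" using D(1) by (simp add: dmatrix_def)
  next
    fix c assume "c \<in> map prod.swap ` D" then show "length c = 5"
      using D(1) unfolding dmatrix_def by fastforce
  next
    fix c d i j assume *: "c \<in> map prod.swap ` D" "d \<in> map prod.swap ` D" "i < (5::nat)" "j < (5::nat)"
      "i \<noteq> j" "c ! i - c ! j - (d ! i - d ! j) \<in> modlat y x"
    obtain c' d' where cd: "c' \<in> D" "c = map prod.swap c'" "d' \<in> D" "d = map prod.swap d'" using * by blast
    have len: "length c' = 5" "length d' = 5" using D(1) cd unfolding dmatrix_def by blast+
    have "(c' ! i - c' ! j) - (d' ! i - d' ! j) \<in> modlat x y"
      using * len by (simp add: cd swap del: swap_simp)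
    then have "c' = d'" using D(1) cd *(3-5) unfolding dmatrix_def by blast
    then show "c = d" using cd by simp
  qed
  moreover have "card (map prod.swap ` D) = y * x"
    using D(2) by (simp add: card_image inj_on_subset[OF inj] mult.commute)
  ultimately show ?thesis unfolding dmatrix_exists_def by blast
qed

text \<open>The sum of two columns is determined in two stages, first modulo \<open>(x, y)\<close>
  and then inside the kernel. So the construction works for extensions, such as \<open>Z_9\<close>
  by \<open>Z_3\<close>, and not only for direct products.\<close>

lemma dmatrix_exists_mult:
  assumes "dmatrix_exists x y" and "dmatrix_exists x' y'" and pos: "x > 0" "y > 0"
  shows "dmatrix_exists (x * x') (y * y')"
proof -
  obtain D where D: "dmatrix (modlat x y) D" "card D = x * y"
    using assms by (auto simp: dmatrix_exists_def)
  obtain E where E: "dmatrix (modlat x' y') E" "card E = x' * y'"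
    using assms by (auto simp: dmatrix_exists_def)
  define h where "h = (\<lambda>(a, b). (int x * a, int y * b) :: int \<times> int)"
  define f where "f = (\<lambda>(c, d). map2 (\<lambda>s t. s + h t) c d)"
  have hd: "h a - h b = h (a - b)" for a b by (cases a; cases b) (simp add: h_def algebra_simps)
  have hL: "h a \<in> modlat (x * x') (y * y') \<longleftrightarrow> a \<in> modlat x' y'" for a
    using pos by (cases a) (simp add: h_def)
  have hM: "h a \<in> modlat x y" for a by (cases a) (simp add: h_def)
  have len: "length c = 5" if "c \<in> D \<or> c \<in> E" for c
    using D(1) E(1) that unfolding dmatrix_def by blast
  have key: "p = q" if *: "p \<in> D \<times> E" "q \<in> D \<times> E" "i < (5::nat)" "j < (5::nat)" "i \<noteq> j"
    "f p ! i - f p ! j - (f q ! i - f q ! j) \<in> modlat (x * x') (y * y')" for p q i j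
  proof -
    obtain c d where p: "p = (c, d)" "c \<in> D" "d \<in> E" using * by blast
    obtain c' d' where q: "q = (c', d')" "c' \<in> D" "d' \<in> E" using * by blast
    have e: "f p ! i - f p ! j - (f q ! i - f q ! j)
       = ((c ! i - c ! j) - (c' ! i - c' ! j)) + h ((d ! i - d ! j) - (d' ! i - d' ! j))"
      using * p q len by (simp add: f_def flip: hd)
    have "f p ! i - f p ! j - (f q ! i - f q ! j) \<in> modlat x y"
      by (rule modlat_mono[OF _ _ *(6)]) auto
    then have "(c ! i - c ! j) - (c' ! i - c' ! j) \<in> modlat x y"
      using modlat_diff[OF _ hM[of "(d ! i - d ! j) - (d' ! i - d' ! j)"],
          of "f p ! i - f p ! j - (f q ! i - f q ! j)"] e by simp
    then have c: "c = c'" using D(1) p q *(3-5) unfolding dmatrix_def by blast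
    then have "(d ! i - d ! j) - (d' ! i - d' ! j) \<in> modlat x' y'" using *(6) e hL by simp
    then have "d = d'" using E(1) p q *(3-5) unfolding dmatrix_def by blast
    then show ?thesis using c p q by simp
  qed
  have inj: "inj_on f (D \<times> E)"
  proof (rule inj_onI)
    fix p q assume "p \<in> D \<times> E" "q \<in> D \<times> E" "f p = f q"
    then show "p = q" by (intro key[of p q 0 1]) simp_all
  qed
  have "dmatrix (modlat (x * x') (y * y')) (f ` (D \<times> E))"
    unfolding dmatrix_def
  proof (intro conjI ballI allI impI)
    show "finite (f ` (D \<times> E))" using D(1) E(1) by (simp add: dmatrix_def)
  next
    fix c assume "c \<in> f ` (D \<times> E)" then show "length c = 5" using len by (auto simp: f_def)
  next
    fix c d i j assume *: "c \<in> f ` (D \<times> E)" "d \<in> f ` (D \<times> E)" "i < (5::nat)" "j < (5::nat)" "i \<noteq> j"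
      "c ! i - c ! j - (d ! i - d ! j) \<in> modlat (x * x') (y * y')"
    obtain p q where pq: "p \<in> D \<times> E" "c = f p" "q \<in> D \<times> E" "d = f q" using *(1,2) by blast
    have "p = q" using key[OF pq(1,3) *(3-5)] *(6) pq by blast
    then show "c = d" using pq by blast
  qed
  moreover have "card (f ` (D \<times> E)) = (x * x') * (y * y')"
    using D(2) E(2) by (simp add: card_image[OF inj] card_cartesian_product algebra_simps)
  ultimately show ?thesis unfolding dmatrix_exists_def by blast
qed

text \<open>Two rows differ by a multiple 1, 2, 3 or 4 up to sign, and these have no prime factor
  other than 2 and 3.\<close>

lemma dmatrix_exists_coprime_6:
  assumes "coprime (x * y) 6" and pos: "x > 0" "y > 0"
  shows "dmatrix_exists x y"
proof -
  define T where "T = {0..<int x} \<times> {0..<int y}"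
  define f where "f = (\<lambda>(a, b). [(0, 0), (a, b), (2 * a, 2 * b), (3 * a, 3 * b), (4 * a, 4 * b)] :: (int \<times> int) list)"
  have nth: "f (a, b) ! i = (int i * a, int i * b)" if "i < 5" for a b i
  proof -
    have "i \<in> {0, 1, 2, 3, 4}" using that by auto
    then show ?thesis by (auto simp: f_def)
  qed
  have cop: "int m dvd a" if "int m dvd (int i - int j) * a" "i < 5" "j < 5" "i \<noteq> j" "coprime m 6" for m a i j
  proof -
    have "coprime m 2" "coprime m 3" using \<open>coprime m 6\<close> coprime_mult_right_iff[of m 2 3] by simp_all
    then have "coprime (int m) 2" "coprime (int m) 3"
      by (metis coprime_int_iff of_nat_numeral)+
    then have "coprime (int m) d" if "d \<in> {-4, -3, -2, -1, 1, 2, 3, 4}" for d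
      using that coprime_mult_right_iff[of "int m" 2 2] by auto
    moreover have "int i - int j \<in> {-4, -3, -2, -1, 1, 2, 3, 4}" using that(2-4) by auto
    ultimately have "coprime (int m) (int i - int j)" by blast
    then show ?thesis using that(1) by (simp add: coprime_dvd_mult_right_iff)
  qed
  have c: "coprime x 6" "coprime y 6" using assms(1) by (simp_all add: coprime_mult_left_iff)
  have key: "p = q" if *: "p \<in> T" "q \<in> T" "i < (5::nat)" "j < (5::nat)" "i \<noteq> j"
    "f p ! i - f p ! j - (f q ! i - f q ! j) \<in> modlat x y" for p q i j
  proof -
    obtain a b where p: "p = (a, b)" by (cases p)
    obtain a' b' where q: "q = (a', b')" by (cases q)
    have "int x dvd (int i - int j) * (a - a')" "int y dvd (int i - int j) * (b - b')"
      using * by (simp_all add: p q nth algebra_simps)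
    then have "int x dvd a - a'" "int y dvd b - b'" using cop *(3-5) c by blast+
    then have "a mod int x = a' mod int x" "b mod int y = b' mod int y"
      by (simp_all add: mod_eq_dvd_iff)
    then show ?thesis using *(1,2) by (simp add: p q T_def)
  qed
  have inj: "inj_on f T"
  proof (rule inj_onI)
    fix p q assume "p \<in> T" "q \<in> T" "f p = f q"
    then show "p = q" by (intro key[of p q 0 1]) simp_all
  qed
  have "dmatrix (modlat x y) (f ` T)"
    unfolding dmatrix_def
  proof (intro conjI ballI allI impI)
    show "finite (f ` T)" by (simp add: T_def)
  next
    fix c assume "c \<in> f ` T" then show "length c = 5" by (auto simp: f_def)
  next
    fix c d i j assume *: "c \<in> f ` T" "d \<in> f ` T" "i < (5::nat)" "j < (5::nat)" "i \<noteq> j"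
      "c ! i - c ! j - (d ! i - d ! j) \<in> modlat x y"
    obtain p q where pq: "p \<in> T" "c = f p" "q \<in> T" "d = f q" using *(1,2) by blast
    have "p = q" using key[OF pq(1,3) *(3-5)] *(6) pq by blast
    then show "c = d" using pq by blast
  qed
  moreover have "card (f ` T) = x * y"
    unfolding card_image[OF inj] by (simp add: T_def card_cartesian_product)
  ultimately show ?thesis unfolding dmatrix_exists_def by blast
qed

section \<open>Explicit packings\<close>

text \<open>Distinctness of long lists of integers is checked by tree sort, which the simplifier
  evaluates in reasonable time.\<close>

datatype search_tree = Tip | Fork search_tree int search_tree

fun insert_tree :: "int \<Rightarrow> search_tree \<Rightarrow> search_tree" where
  "insert_tree k Tip = Fork Tip k Tip"
| "insert_tree k (Fork l x r) =
     (if k < x then Fork (insert_tree k l) x r else Fork l x (insert_tree k r))"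

fun inorder_append :: "search_tree \<Rightarrow> int list \<Rightarrow> int list" where
  "inorder_append Tip xs = xs"
| "inorder_append (Fork l x r) xs = inorder_append l (x # inorder_append r xs)"

fun increasing :: "int list \<Rightarrow> bool" where
  "increasing (x # y # xs) \<longleftrightarrow> x < y \<and> increasing (y # xs)"
| "increasing _ \<longleftrightarrow> True"

definition tree_sort :: "int list \<Rightarrow> int list" where
  "tree_sort xs = inorder_append (fold insert_tree xs Tip) []"

primrec mset_search_tree :: "search_tree \<Rightarrow> int multiset" where
  "mset_search_tree Tip = {#}"
| "mset_search_tree (Fork l x r) = add_mset x (mset_search_tree l + mset_search_tree r)"

lemma mset_inorder_append: "mset (inorder_append t xs) = mset_search_tree t + mset xs"
  by (induction t arbitrary: xs) simp_all

lemma mset_insert_tree: "mset_search_tree (insert_tree k t) = add_mset k (mset_search_tree t)"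
  by (induction t) simp_all

lemma mset_tree_sort: "mset (tree_sort xs) = mset xs"
proof -
  have "mset_search_tree (fold insert_tree xs t) = mset xs + mset_search_tree t" for t
    by (induction xs arbitrary: t) (simp_all add: mset_insert_tree)
  then show ?thesis by (simp add: tree_sort_def mset_inorder_append)
qed

lemma increasing_Cons: "increasing (x # xs) \<longleftrightarrow> (\<forall>y\<in>set xs. x < y) \<and> increasing xs"
proof (induction xs arbitrary: x)
  case (Cons y ys)
  have "(\<forall>z\<in>set ys. x < z)" if "x < y" "\<forall>z\<in>set ys. y < z"
    using that by (meson less_trans)
  then show ?case using Cons[of y] by (simp del: Cons) blast
qed simp

lemma distinct_if_increasing_tree_sort:
  assumes "increasing (tree_sort xs)"
  shows "distinct xs"
proof -
  have "distinct ys" if "increasing ys" for ys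
    using that by (induction ys) (auto simp: increasing_Cons)
  then show ?thesis using assms mset_eq_imp_distinct_iff[OF mset_tree_sort] by blast
qed

definition list_positions :: "'a list list \<Rightarrow> ('a list \<times> nat \<times> nat) list" where
  "list_positions Bs = [(B, i, j). B \<leftarrow> Bs, i \<leftarrow> [0..<length B], j \<leftarrow> [0..<length B], i \<noteq> j]"

lemma mem_list_positions:
  "(B, i, j) \<in> set (list_positions Bs) \<longleftrightarrow> B \<in> set Bs \<and> i < length B \<and> j < length B \<and> i \<noteq> j"
  by (auto simp: list_positions_def)

text \<open>Blocks are counted on a list, so the list must be free of repetitions; a repeated block
  would repeat its positions.\<close>

lemma distinct_if_distinct_list_positions:
  assumes "distinct (list_positions Bs)" and "\<And>B. B \<in> set Bs \<Longrightarrow> length B \<in> {4, 5}"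
  shows "distinct Bs"
  using assms
proof (induction Bs)
  case (Cons B Bs)
  have "0 < length B \<and> 1 < length B" using Cons.prems(2)[of B] by auto
  then have "(B, 0, 1) \<in> set (list_positions [B])" by (simp add: mem_list_positions)
  moreover have "list_positions (B # Bs) = list_positions [B] @ list_positions Bs"
    by (simp add: list_positions_def)
  ultimately have "(B, 0, 1) \<notin> set (list_positions Bs)" "distinct (list_positions Bs)"
    using Cons.prems(1) by auto
  then show ?case using Cons \<open>0 < length B \<and> 1 < length B\<close> by (simp add: mem_list_positions)
qed simp

fun residue_key :: "int \<Rightarrow> int \<Rightarrow> point \<Rightarrow> int" where
  "residue_key u v ((a, b), (x, y)) = ((8 * (a mod 4) + b mod 8) * u + x mod u) * v + y mod v"

fun in_hole :: "int \<Rightarrow> int \<Rightarrow> point \<Rightarrow> bool" where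
  "in_hole r s ((a, b), (x, y)) \<longleftrightarrow> x mod r = 0 \<and> y mod s = 0"

definition explicit_packing :: "('a::ab_group_add \<Rightarrow> int) \<Rightarrow> nat \<Rightarrow> 'a list list \<Rightarrow> bool" where
  "explicit_packing key n Bs \<longleftrightarrow>
     list_all (\<lambda>B. length B = 4 \<or> length B = 5) Bs \<and>
     length (filter (\<lambda>B. length B = 4) Bs) = n \<and> length (filter (\<lambda>B. length B = 5) Bs) = n \<and>
     increasing (tree_sort (map (\<lambda>(B, i, j). key (B ! i - B ! j)) (list_positions Bs)))"

definition avoids_hole :: "int \<Rightarrow> int \<Rightarrow> point list list \<Rightarrow> bool" where
  "avoids_hole r s Bs \<longleftrightarrow> list_all (\<lambda>(B, i, j). \<not> in_hole r s (B ! i - B ! j)) (list_positions Bs)"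

lemma residue_key_eq:
  assumes "x - y \<in> modlat 4 8 \<times> modlat u v"
  shows "residue_key (int u) (int v) x = residue_key (int u) (int v) y"
proof -
  obtain a b c d a' b' c' d' where xy: "x = ((a, b), (c, d))" "y = ((a', b'), (c', d'))"
    by (metis surj_pair)
  show ?thesis using assms unfolding xy by (simp flip: mod_eq_dvd_iff)
qed

text \<open>Since \<open>key\<close> is constant on cosets of \<open>L\<close>, positions with
  distinct keys have differences in distinct cosets. The positions contain the blocks themselves, so
  distinct keys also make the blocks distinct.\<close>

lemma packable_explicit:
  assumes "explicit_packing key n Bs" and key: "\<And>x y. x - y \<in> L \<Longrightarrow> key x = key y" and "0 \<in> L"
    and X: "\<And>B i j. (B, i, j) \<in> set (list_positions Bs) \<Longrightarrow> B ! i - B ! j \<in> X"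
  shows "packable (L) X n"
proof -
  let ?key = "\<lambda>(B, i, j). key (B ! i - B ! j)"
  have "distinct (map ?key (list_positions Bs))"
    using assms(1) distinct_if_increasing_tree_sort by (simp only: explicit_packing_def)
  then have d: "distinct (list_positions Bs)" and inj: "inj_on ?key (set (list_positions Bs))"
    by (simp_all only: distinct_map)
  have len: "length B \<in> {4, 5}" if "B \<in> set Bs" for B
    using assms(1) that by (auto simp: explicit_packing_def list_all_iff)
  have dB: "distinct Bs" using distinct_if_distinct_list_positions[OF d len] .
  show ?thesis
  proof (rule packableI)
    show "packs (L) X (\<lambda>B. B) (set Bs)"
    proof (rule packsI)
      fix B assume "B \<in> set Bs" then show "length B \<in> {4, 5}" by (rule len)
    next
      fix B i j assume "B \<in> set Bs" "i < length B" "j < length B" "i \<noteq> j"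
      then show "B ! i - B ! j \<in> X" by (intro X) (simp add: mem_list_positions)
    next
      fix B C i j k l assume *: "B \<in> set Bs" "C \<in> set Bs" "i < length B" "j < length B" "i \<noteq> j"
        "k < length C" "l < length C" "k \<noteq> l" "B ! i - B ! j - (C ! k - C ! l) \<in> L"
      have "?key (B, i, j) = ?key (C, k, l)" using key[OF *(9)] by simp
      moreover have "(B, i, j) \<in> set (list_positions Bs)" "(C, k, l) \<in> set (list_positions Bs)"
        using * by (simp_all add: mem_list_positions)
      ultimately have "(B, i, j) = (C, k, l)" using inj_onD[OF inj] by blast
      then show "B = C \<and> i = k \<and> j = l" by simp
    qed simp
  next
    show "card {B \<in> set Bs. length B = 4} = n" "card {B \<in> set Bs. length B = 5} = n"
      using assms(1) distinct_card[OF distinct_filter[OF dB]]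
      by (simp_all add: explicit_packing_def flip: set_filter)
  qed fact
qed

lemma rel_packable_explicit:
  assumes E: "explicit_packing (residue_key (int u) (int v)) n Bs" and A: "avoids_hole (int r) (int s) Bs"
    and "r dvd u" "s dvd v" "n = u * v - (u div r) * (v div s)"
  shows "rel_packable u v r s"
proof -
  have "packable (modlat 4 8 \<times> modlat u v) (- (UNIV \<times> modlat r s)) n"
  proof (rule packable_explicit[OF E residue_key_eq])
    fix B i j assume "(B, i, j) \<in> set (list_positions Bs)"
    then have "\<not> in_hole (int r) (int s) (B ! i - B ! j)"
      using A by (auto simp: avoids_hole_def list_all_iff)
    moreover obtain a b x y where "B ! i - B ! j = ((a, b), (x, y))" by (metis surj_pair)
    ultimately show "B ! i - B ! j \<in> - (UNIV \<times> modlat r s)"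
      by (simp add: dvd_eq_mod_eq_0)
  qed simp_all
  then show ?thesis using assms(3-5) by (simp add: rel_packable_def)
qed

section \<open>Explicit difference matrices\<close>

definition explicit_dmatrix :: "('a::ab_group_add \<Rightarrow> int) \<Rightarrow> 'a list list \<Rightarrow> bool" where
  "explicit_dmatrix key cs \<longleftrightarrow> list_all (\<lambda>c. length c = 5) cs \<and>
     list_all (\<lambda>i. list_all (\<lambda>j. i = j \<or>
       increasing (tree_sort (map (\<lambda>c. key (c ! i - c ! j)) cs))) [0..<5]) [0..<5]"

lemma dmatrix_explicit:
  assumes "explicit_dmatrix key cs" and key: "\<And>x y. x - y \<in> L \<Longrightarrow> key x = key y"
  shows "dmatrix L (set cs)" and "card (set cs) = length cs"
proof -
  have d: "distinct (map (\<lambda>c. key (c ! i - c ! j)) cs)" if "i < 5" "j < 5" "i \<noteq> j" for i j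
  proof (rule distinct_if_increasing_tree_sort)
    have "\<forall>i\<in>{0..<5}. \<forall>j\<in>{0..<5}. i = j \<or> increasing (tree_sort (map (\<lambda>c. key (c ! i - c ! j)) cs))"
      using assms(1) by (simp add: explicit_dmatrix_def list_all_iff)
    from bspec[OF bspec[OF this, of i], of j] that
    show "increasing (tree_sort (map (\<lambda>c. key (c ! i - c ! j)) cs))" by simp
  qed
  show "dmatrix L (set cs)"
    unfolding dmatrix_def
  proof (intro conjI ballI allI impI)
    fix c assume "c \<in> set cs" then show "length c = 5"
      using assms(1) by (simp add: explicit_dmatrix_def list_all_iff)
  next
    fix c c' i j assume *: "c \<in> set cs" "c' \<in> set cs" "i < (5::nat)" "j < (5::nat)" "i \<noteq> j"
      "c ! i - c ! j - (c' ! i - c' ! j) \<in> L"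
    have "inj_on (\<lambda>c. key (c ! i - c ! j)) (set cs)" using d[OF *(3-5)] by (simp add: distinct_map)
    then show "c = c'" using key[OF *(6)] *(1,2) by (rule inj_onD)
  qed simp
  show "card (set cs) = length cs"
    using d[of 0 1] by (intro distinct_card) (simp add: distinct_map)
qed

fun pair_key :: "int \<Rightarrow> int \<Rightarrow> int \<times> int \<Rightarrow> int" where
  "pair_key m n (a, b) = (a mod m) * n + b mod n"

lemma pair_key_eq: "x - y \<in> modlat m n \<Longrightarrow> pair_key (int m) (int n) x = pair_key (int m) (int n) y"
  by (cases x; cases y) (simp flip: mod_eq_dvd_iff)

lemma dmatrix_exists_explicit:
  assumes "explicit_dmatrix (pair_key (int x) (int y)) cs" and "length cs = x * y"
  shows "dmatrix_exists x y"
  unfolding dmatrix_exists_def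
  using dmatrix_explicit[OF assms(1) pair_key_eq] assms(2) by auto

text \<open>The rows are the multiples by \<open>0, 1, 2, i, 1 + i\<close> in the field \<open>Z\<^sub>3[i]\<close>.\<close>

lemma dmatrix_exists_3_3: "dmatrix_exists 3 3"
proof (rule dmatrix_exists_explicit)
  show "explicit_dmatrix (pair_key (int 3) (int 3))
     [[(0, 0), (a, b), (2 * a, 2 * b), (- b, a), (a - b, a + b)]. a \<leftarrow> [0..2], b \<leftarrow> [0..2]]"
    by code_simp
qed (simp add: upto.simps)

text \<open>Residues modulo 162. Their 5 * 12 + 5 * 20 = 160 differences are all the elements other
  than 0 and 81.\<close>

definition blocks_162 :: "int list list" where
  "blocks_162 = [
    [0, 1, 23, 33],
    [0, 5, 19, 72],
    [0, 29, 68, 106],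
    [0, 2, 36, 43],
    [0, 4, 46, 91],
    [0, 150, 89, 110, 6],
    [0, 98, 51, 147, 20],
    [0, 132, 82, 69, 25],
    [0, 114, 26, 54, 17],
    [0, 100, 103, 92, 76]]"

text \<open>The matrix is closed under negation: its other columns are the negatives of these and
  the zero column.\<close>

definition half_columns_27 :: "int list list" where
  "half_columns_27 = [
    [0, 1, 24, 21, 20], [0, 2, 1, 19, 26], [0, 3, 19, 25, 2],
    [0, 4, 25, 10, 22], [0, 5, 10, 24, 19], [0, 6, 13, 9, 18],
    [0, 7, 15, 22, 14], [0, 8, 18, 26, 12], [0, 9, 22, 20, 3],
    [0, 10, 7, 23, 21], [0, 11, 23, 13, 16], [0, 12, 21, 16, 10],
    [0, 13, 11, 12, 23]]"

text \<open>The matrix is normalized: the first row is zero and the second runs through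
  \<open>Z_4 x Z_4\<close>. A group of even order with cyclic Sylow 2-subgroups has no difference
  matrix of index 1 with three rows, so a cyclic 2-group could not be the kernel.\<close>

definition columns_4_4 :: "(int \<times> int) list list" where
  "columns_4_4 = [
    [(0,0), (0,0), (0,0), (0,0), (0,0)], [(0,0), (0,1), (0,2), (2,0), (3,3)],
    [(0,0), (0,2), (0,1), (3,0), (1,1)], [(0,0), (0,3), (1,1), (0,1), (2,3)],
    [(0,0), (1,0), (2,0), (2,2), (0,1)], [(0,0), (1,1), (3,0), (3,3), (1,3)],
    [(0,0), (1,2), (3,2), (2,3), (2,2)], [(0,0), (1,3), (3,1), (1,2), (0,2)],
    [(0,0), (2,0), (1,0), (1,1), (0,3)], [(0,0), (2,1), (1,2), (3,1), (3,2)],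
    [(0,0), (2,2), (3,3), (0,3), (3,0)], [(0,0), (2,3), (2,1), (1,3), (2,0)],
    [(0,0), (3,0), (0,3), (1,0), (1,2)], [(0,0), (3,1), (2,3), (3,2), (2,1)],
    [(0,0), (3,2), (1,3), (2,1), (3,1)], [(0,0), (3,3), (2,2), (0,2), (1,0)]]"

lemma dmatrix_exists_27: "dmatrix_exists 27 1"
proof (rule dmatrix_exists_explicit)
  show "explicit_dmatrix (pair_key (int 27) (int 1))
     (map (map (\<lambda>x. (x, 0))) ([0, 0, 0, 0, 0] # half_columns_27 @ map (map uminus) half_columns_27))"
    by code_simp
qed (simp add: half_columns_27_def)

text \<open>A difference family of \<open>Z\<^sub>1\<^sub>6\<^sub>2\<close> relative to its subgroup of order 2 is lifted along the
  projection \<open>Z\<^sub>4 \<times> Z\<^sub>8 \<times> Z\<^sub>8\<^sub>1 \<rightarrow> Z\<^sub>2 \<times> Z\<^sub>8\<^sub>1\<close>, whose kernel is isomorphic to \<open>Z\<^sub>4 \<times> Z\<^sub>4\<close>.\<close>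

fun key_162 :: "point \<Rightarrow> int" where
  "key_162 ((a, b), (x, y)) = 81 * (b mod 2) + x mod 81"

fun key_4_4 :: "point \<Rightarrow> int" where
  "key_4_4 ((a, b), (x, y)) = 8 * (a mod 4) + b mod 8"

lemma rel_packable_81: "rel_packable 81 1 81 1"
proof -
  \<comment> \<open>By Chinese remaindering, a residue modulo 162 is given by its parity, read off
    from the \<open>Z_8\<close> coordinate, and its residue modulo 81.\<close>
  let ?Bs = "map (map (\<lambda>z. ((0, z), (z, 0)))) blocks_162 :: point list list"
  let ?cs = "map (map (\<lambda>(a, b). ((a, 2 * b), (0, 0)))) columns_4_4 :: point list list"
  have E: "explicit_packing key_162 5 ?Bs" by code_simp
  have A: "avoids_hole 81 1 ?Bs" by code_simp
  have base: "packable (modlat 1 2 \<times> modlat 81 1) (- (UNIV \<times> modlat 81 1)) 5"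
  proof (rule packable_explicit[OF E])
    fix x y :: point assume *: "x - y \<in> modlat 1 2 \<times> modlat 81 1"
    obtain a b c d a' b' c' d' where xy: "x = ((a, b), (c, d))" "y = ((a', b'), (c', d'))"
      by (metis surj_pair)
    show "key_162 x = key_162 y" using * unfolding xy by (simp flip: mod_eq_dvd_iff)
  next
    fix B i j assume "(B, i, j) \<in> set (list_positions ?Bs)"
    then have "\<not> in_hole 81 1 (B ! i - B ! j)"
      using A unfolding avoids_hole_def list_all_iff by blast
    moreover obtain a b x y where "B ! i - B ! j = ((a, b), (x, y))" by (metis surj_pair)
    ultimately show "B ! i - B ! j \<in> - (UNIV \<times> modlat 81 1)"
      by (simp add: dvd_eq_mod_eq_0)
  qed (simp add: zero_prod_def)
  have D: "explicit_dmatrix key_4_4 ?cs" by code_simp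
  have key: "key_4_4 x = key_4_4 y" if *: "x - y \<in> modlat 4 8 \<times> modlat 81 1" for x y :: point
  proof -
    obtain a b c d a' b' c' d' where xy: "x = ((a, b), (c, d))" "y = ((a', b'), (c', d'))"
      by (metis surj_pair)
    show ?thesis using * unfolding xy by (simp flip: mod_eq_dvd_iff)
  qed
  have "packable (modlat 4 8 \<times> modlat 81 1) (- (UNIV \<times> modlat 81 1)) (5 * card (set ?cs))"
  proof (rule packable_lift[OF base dmatrix_explicit(1)[OF D key]])
    fix c assume "c \<in> set ?cs" then show "set c \<subseteq> modlat 1 2 \<times> modlat 81 1" by auto
  next
    show "modlat 4 8 \<times> modlat 81 1 \<subseteq> modlat 1 2 \<times> modlat 81 1"
    proof -
      have "(2::int) dvd x" if "8 dvd x" for x using dvd_trans[OF _ that, of 2] by simp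
      then show ?thesis by auto
    qed
  next
    fix x y assume "x \<in> modlat 1 2 \<times> modlat 81 1" "y \<in> modlat 1 2 \<times> modlat 81 1"
    then show "x - y \<in> modlat 1 2 \<times> modlat 81 1"
      by (cases x; cases y) (auto intro: dvd_diff)
  next
    fix x y :: point assume *: "x \<in> - (UNIV \<times> modlat 81 1)" "y \<in> modlat 1 2 \<times> modlat 81 1"
    then show "x + y \<in> - (UNIV \<times> modlat 81 1)"
      using modlat_diff[of "snd x + snd y" 81 1 "snd y"] by (cases x; cases y) auto
  qed simp_all
  moreover have "card (set ?cs) = 16"
    unfolding dmatrix_explicit(2)[OF D key] by (simp add: columns_4_4_def)
  ultimately show ?thesis by (simp add: rel_packable_def)
qed

section \<open>Multiplying templates by residues modulo a prime\<close>

type_synonym label = "(int \<times> int) \<times> int"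

text \<open>A template block with tag \<open>c\<close> consists of labels in \<open>Z\<^sub>4 \<times> Z\<^sub>8 \<times> Z\<^sub>w\<close> and row codes \<open>r\<close>; it is
  developed to the blocks of points \<open>(label, \<rho> r * t)\<close> for the multipliers \<open>t \<in> T c\<close>.\<close>

definition template_positions ::
    "('c \<times> 'e list) list \<Rightarrow> (('c \<times> 'e list) \<times> nat \<times> nat) list" where
  "template_positions Bs =
     [(b, i, j). b \<leftarrow> Bs, i \<leftarrow> [0..<length (snd b)], j \<leftarrow> [0..<length (snd b)], i \<noteq> j]"

lemma mem_template_positions:
  "(b, i, j) \<in> set (template_positions Bs) \<longleftrightarrow>
     b \<in> set Bs \<and> i < length (snd b) \<and> j < length (snd b) \<and> i \<noteq> j"
  by (auto simp: template_positions_def)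

fun label_key :: "int \<Rightarrow> label \<Rightarrow> int" where
  "label_key w ((a, b), x) = (8 * (a mod 4) + b mod 8) * w + x mod w"

definition position_label :: "int \<Rightarrow> ('c \<times> (label \<times> 'r) list) \<times> nat \<times> nat \<Rightarrow> int" where
  "position_label w = (\<lambda>(b, i, j). label_key w (fst (snd b ! i) - fst (snd b ! j)))"

definition well_sized :: "('c \<times> 'e list) list \<Rightarrow> bool" where
  "well_sized Bs \<longleftrightarrow> distinct Bs \<and> list_all (\<lambda>b. length (snd b) = 4 \<or> length (snd b) = 5) Bs"

text \<open>A position with label x and row difference d develops into the differences (x, d * t).
  For one position the multipliers t are told apart because d is a unit; different positions with
  the same label are told apart by \<open>sep\<close>. The coordinate in \<open>Z_w\<close> belongs
  to the label and is not multiplied.\<close>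

lemma packable_template:
  fixes Bs :: "('c \<times> (label \<times> 'r) list) list" and \<rho> :: "'r \<Rightarrow> int" and T :: "'c \<Rightarrow> int set"
  assumes p: "prime p" and size: "well_sized Bs"
    and fin: "\<And>c. finite (T c)"
    and T_inj: "\<And>c t t'. t \<in> T c \<Longrightarrow> t' \<in> T c \<Longrightarrow> int p dvd t - t' \<Longrightarrow> t = t'"
    and T_unit: "\<And>c t. t \<in> T c \<Longrightarrow> \<not> int p dvd t"
    and unit: "\<And>b i j. (b, i, j) \<in> set (template_positions Bs) \<Longrightarrow>
      \<not> int p dvd \<rho> (snd (snd b ! i)) - \<rho> (snd (snd b ! j))"
    and sep: "\<And>b i j c k l t t'. (b, i, j) \<in> set (template_positions Bs) \<Longrightarrow>
      (c, k, l) \<in> set (template_positions Bs) \<Longrightarrow> (b, i, j) \<noteq> (c, k, l) \<Longrightarrow>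
      position_label (int w) (b, i, j) = position_label (int w) (c, k, l) \<Longrightarrow>
      t \<in> T (fst b) \<Longrightarrow> t' \<in> T (fst c) \<Longrightarrow>
      \<not> int p dvd (\<rho> (snd (snd b ! i)) - \<rho> (snd (snd b ! j))) * t -
                  (\<rho> (snd (snd c ! k)) - \<rho> (snd (snd c ! l))) * t'"
    and c4: "(\<Sum>b\<leftarrow>filter (\<lambda>b. length (snd b) = 4) Bs. card (T (fst b))) = n"
    and c5: "(\<Sum>b\<leftarrow>filter (\<lambda>b. length (snd b) = 5) Bs. card (T (fst b))) = n"
  shows "packable (modlat 4 8 \<times> modlat w p) (- (UNIV \<times> modlat 1 p)) n"
proof -
  define pt :: "int \<Rightarrow> label \<times> 'r \<Rightarrow> point" where
    "pt = (\<lambda>t ((l, x), r). (l, (x, \<rho> r * t)))"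
  define f :: "('c \<times> (label \<times> 'r) list) \<times> int \<Rightarrow> point list" where
    "f = (\<lambda>(b, t). map (pt t) (snd b))"
  define I where "I = (SIGMA b:set Bs. T (fst b))"
  have pt_diff: "pt t e - pt t e' =
      (fst (fst e - fst e'), (snd (fst e - fst e'), (\<rho> (snd e) - \<rho> (snd e')) * t))" for t e e'
    by (cases e; cases e') (auto simp: pt_def algebra_simps)
  have pint: "prime (int p)" using p by simp
  have len: "length (snd b) \<in> {4, 5}" if "b \<in> set Bs" for b
    using size that by (auto simp: well_sized_def list_all_iff)
  have packs: "packs (modlat 4 8 \<times> modlat w p) (- (UNIV \<times> modlat 1 p)) f I"
  proof (rule packsI)
    show "finite I" unfolding I_def using fin by simp
  next
    fix a assume "a \<in> I"
    then obtain b t where "a = (b, t)" "b \<in> set Bs" by (auto simp: I_def)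
    then show "length (f a) \<in> {4, 5}" using len[of b] by (simp add: f_def)
  next
    fix a i j assume *: "a \<in> I" "i < length (f a)" "j < length (f a)" "i \<noteq> j"
    obtain b t where a: "a = (b, t)" "b \<in> set Bs" "t \<in> T (fst b)" using *(1) by (auto simp: I_def)
    have ij: "i < length (snd b)" "j < length (snd b)" using * by (simp_all add: a f_def)
    have "\<not> int p dvd (\<rho> (snd (snd b ! i)) - \<rho> (snd (snd b ! j))) * t"
      using unit[of b i j] T_unit[OF a(3)] ij a(2) *(4) prime_dvd_mult_iff[OF pint]
      by (simp add: mem_template_positions)
    then show "f a ! i - f a ! j \<in> - (UNIV \<times> modlat 1 p)"
      using ij by (simp add: a(1) f_def pt_diff)
  next
    fix a a' i j k l assume *: "a \<in> I" "a' \<in> I" "i < length (f a)" "j < length (f a)" "i \<noteq> j"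
      "k < length (f a')" "l < length (f a')" "k \<noteq> l"
      "f a ! i - f a ! j - (f a' ! k - f a' ! l) \<in> modlat 4 8 \<times> modlat w p"
    obtain b t where a: "a = (b, t)" "b \<in> set Bs" "t \<in> T (fst b)" using *(1) by (auto simp: I_def)
    obtain c t' where a': "a' = (c, t')" "c \<in> set Bs" "t' \<in> T (fst c)" using *(2) by (auto simp: I_def)
    have ij: "i < length (snd b)" "j < length (snd b)" using * by (simp_all add: a f_def)
    have kl: "k < length (snd c)" "l < length (snd c)" using * by (simp_all add: a' f_def)
    let ?d = "\<rho> (snd (snd b ! i)) - \<rho> (snd (snd b ! j))"
    let ?e = "\<rho> (snd (snd c ! k)) - \<rho> (snd (snd c ! l))"
    obtain x1 x2 x3 where x: "fst (snd b ! i) - fst (snd b ! j) = ((x1, x2), x3)" by (metis surj_pair)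
    obtain y1 y2 y3 where y: "fst (snd c ! k) - fst (snd c ! l) = ((y1, y2), y3)" by (metis surj_pair)
    have m: "((x1, x2), (x3, ?d * t)) - ((y1, y2), (y3, ?e * t')) \<in> modlat 4 8 \<times> modlat w p"
      using *(9) ij kl by (simp add: a(1) a'(1) f_def pt_diff x y)
    have lab: "position_label (int w) (b, i, j) = position_label (int w) (c, k, l)"
      using m by (simp add: position_label_def x y flip: mod_eq_dvd_iff)
    have dt: "int p dvd ?d * t - ?e * t'" using m by simp
    have pos: "(b, i, j) \<in> set (template_positions Bs)" "(c, k, l) \<in> set (template_positions Bs)"
      using ij kl a(2) a'(2) *(5,8) by (simp_all add: mem_template_positions)
    have "\<not> (b, i, j) \<noteq> (c, k, l)"
    proof
      assume "(b, i, j) \<noteq> (c, k, l)"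
      from sep[OF pos this lab a(3) a'(3)] dt show False by (rule notE)
    qed
    then have eq: "c = b" "k = i" "l = j" by simp_all
    have "?d * t - ?e * t' = ?d * (t - t')" unfolding eq by (simp add: algebra_simps)
    then have "int p dvd ?d * (t - t')" using dt by (simp only:)
    then have "int p dvd t - t'" using unit[OF pos(1)] prime_dvd_multD[OF pint] by blast
    with a(3) a'(3)[unfolded eq] have "t = t'" by (rule T_inj)
    then show "a = a' \<and> i = k \<and> j = l" unfolding a(1) a'(1) eq by simp
  qed
  have "card {a \<in> I. length (f a) = m} = (\<Sum>b\<leftarrow>filter (\<lambda>b. length (snd b) = m) Bs. card (T (fst b)))" for m
  proof -
    have "{a \<in> I. length (f a) = m} = (SIGMA b:set (filter (\<lambda>b. length (snd b) = m) Bs). T (fst b))"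
      by (auto simp: I_def f_def)
    then have "card {a \<in> I. length (f a) = m}
        = (\<Sum>b\<in>set (filter (\<lambda>b. length (snd b) = m) Bs). card (T (fst b)))"
      using fin by (simp add: card_SigmaI)
    also have "\<dots> = (\<Sum>b\<leftarrow>filter (\<lambda>b. length (snd b) = m) Bs. card (T (fst b)))"
      using size by (intro sum.distinct_set_conv_list) (simp add: well_sized_def)
    finally show ?thesis .
  qed
  then show ?thesis using packableI[OF packs _, of n] c4 c5 by simp
qed

text \<open>The last bit of the key is the sign, so each pair of a label and a sign occurs at most
  once. With 2w blocks of each size there are 64w positions, as many as pairs, so each pair occurs
  exactly once.\<close>

definition sign_template :: "int \<Rightarrow> ('r \<Rightarrow> 'r \<Rightarrow> bool) \<Rightarrow> ('c \<times> (label \<times> 'r) list) list \<Rightarrow> bool" where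
  "sign_template w \<sigma> Bs \<longleftrightarrow> well_sized Bs \<and>
     increasing (tree_sort (map (\<lambda>(b, i, j). 2 * position_label w (b, i, j) +
       (if \<sigma> (snd (snd b ! i)) (snd (snd b ! j)) then 1 else 0)) (template_positions Bs)))"

lemma sign_templateD:
  assumes "sign_template w \<sigma> Bs" and "(b, i, j) \<in> set (template_positions Bs)"
    and "(c, k, l) \<in> set (template_positions Bs)" and "(b, i, j) \<noteq> (c, k, l)"
    and "position_label w (b, i, j) = position_label w (c, k, l)"
  shows "\<sigma> (snd (snd b ! i)) (snd (snd b ! j)) \<noteq> \<sigma> (snd (snd c ! k)) (snd (snd c ! l))"
proof
  let ?key = "\<lambda>(b, i, j). 2 * position_label w (b, i, j) +
       (if \<sigma> (snd (snd b ! i)) (snd (snd b ! j)) then 1 else 0)"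
  assume eq: "\<sigma> (snd (snd b ! i)) (snd (snd b ! j)) = \<sigma> (snd (snd c ! k)) (snd (snd c ! l))"
  have "distinct (map ?key (template_positions Bs))"
    by (rule distinct_if_increasing_tree_sort) (use assms(1) in \<open>simp only: sign_template_def\<close>)
  then have "inj_on ?key (set (template_positions Bs))" by (simp only: distinct_map)
  moreover have "?key (b, i, j) = ?key (c, k, l)" using assms(5) eq by (simp only: prod.case)
  ultimately have "(b, i, j) = (c, k, l)" using assms(2,3) by (rule inj_onD)
  with assms(4) show False by (rule notE)
qed

section \<open>Quadratic residues\<close>

text \<open>A vertex splits the others into those it beats and those that beat it. One of the two
  classes has at least \<open>2 ^ k\<close> elements; the vertex is put before or after a sequence
  found there.\<close>

lemma transitive_subtournament:
  fixes V :: "'a set"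
  assumes "finite V" and "card V \<ge> 2 ^ k"
    and "\<And>x y. x \<in> V \<Longrightarrow> y \<in> V \<Longrightarrow> x \<noteq> y \<Longrightarrow> R x y \<or> R y x"
  shows "\<exists>xs. length xs = Suc k \<and> set xs \<subseteq> V \<and> sorted_wrt R xs"
  using assms
proof (induction k arbitrary: V)
  case 0
  then obtain v where "v \<in> V" by (metis One_nat_def card.empty ex_in_conv not_one_le_zero power_0)
  then show ?case by (intro exI[of _ "[v]"]) simp
next
  case (Suc k)
  have "card V \<noteq> 0" using Suc.prems(2) by (metis le_zero_eq power_not_zero zero_neq_numeral)
  then obtain v where v: "v \<in> V" by fastforce
  define A where "A = {x \<in> V - {v}. R v x}"
  define B where "B = {x \<in> V - {v}. R x v}"
  have fin: "finite A" "finite B" using Suc.prems(1) by (auto simp: A_def B_def)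
  have "V - {v} \<subseteq> A \<union> B" using Suc.prems(3) v by (auto simp: A_def B_def)
  then have "card (V - {v}) \<le> card A + card B"
    by (meson card_Un_le card_mono fin finite_UnI le_trans)
  then have "card V \<le> card A + card B + 1" using Suc.prems(1) v by (simp add: card_Diff_singleton)
  then consider "2 ^ k \<le> card A" | "2 ^ k \<le> card B" using Suc.prems(2) by fastforce
  then show ?case
  proof cases
    case 1
    have "A \<subseteq> V" by (auto simp: A_def)
    then obtain xs where xs: "length xs = Suc k" "set xs \<subseteq> A" "sorted_wrt R xs"
      using Suc.IH[OF fin(1) 1] Suc.prems(3) by (meson subsetD)
    then show ?thesis using \<open>A \<subseteq> V\<close> v by (intro exI[of _ "v # xs"]) (auto simp: A_def)
  next
    case 2
    have "B \<subseteq> V" by (auto simp: B_def)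
    then obtain xs where xs: "length xs = Suc k" "set xs \<subseteq> B" "sorted_wrt R xs"
      using Suc.IH[OF fin(2) 2] Suc.prems(3) by (meson subsetD)
    then show ?thesis using \<open>B \<subseteq> V\<close> v
      by (intro exI[of _ "xs @ [v]"]) (auto simp: B_def sorted_wrt_append)
  qed
qed

locale odd_prime =
  fixes p :: nat
  assumes prime_p: "prime p" and p_gt_2: "2 < p"
begin

abbreviation \<chi> :: "int \<Rightarrow> int" where "\<chi> a \<equiv> Legendre a (int p)"

lemma prime_int_p: "prime (int p)"
  using prime_p by simp

lemma odd_p: "odd p"
  using prime_p p_gt_2 prime_odd_nat by blast

lemma chi_eq_0_iff: "\<chi> a = 0 \<longleftrightarrow> int p dvd a"
  by (simp add: Legendre_def cong_0_iff)

lemma chi_cases: "\<not> int p dvd a \<Longrightarrow> \<chi> a = 1 \<or> \<chi> a = - 1"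
  by (simp add: Legendre_def cong_0_iff)

lemma chi_cong: "int p dvd a - b \<Longrightarrow> \<chi> a = \<chi> b"
proof -
  assume "int p dvd a - b"
  then have "[a = b] (mod int p)" by (simp add: cong_iff_dvd_diff)
  then have "[a = 0] (mod int p) \<longleftrightarrow> [b = 0] (mod int p)" "[y\<^sup>2 = a] (mod int p) \<longleftrightarrow> [y\<^sup>2 = b] (mod int p)" for y
    by (meson cong_trans cong_sym)+
  then show ?thesis by (simp add: Legendre_def QuadRes_def)
qed

lemma eq_if_dvd_diff_small: "int p dvd a - b \<Longrightarrow> \<bar>a - b\<bar> < int p \<Longrightarrow> a = b"
  using dvd_imp_le_int[of "a - b" "int p"] by fastforce

text \<open>The values -1, 0 and 1 are distinct modulo p because p > 2, so congruences such as
  Euler's criterion give equalities.\<close>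

lemma chi_eqI:
  assumes "[\<chi> a = x] (mod int p)" and "x \<in> {-1, 0, 1}"
  shows "\<chi> a = x"
proof (rule eq_if_dvd_diff_small)
  show "int p dvd \<chi> a - x" using assms(1) by (simp add: cong_iff_dvd_diff)
  have "\<chi> a \<in> {-1, 0, 1}" by (simp add: Legendre_def)
  then show "\<bar>\<chi> a - x\<bar> < int p" using assms(2) p_gt_2 by auto
qed

lemma chi_mult: "\<chi> (a * b) = \<chi> a * \<chi> b"
proof (rule chi_eqI)
  have e: "[\<chi> c = c ^ ((p - 1) div 2)] (mod int p)" for c
    by (rule euler_criterion[OF prime_p p_gt_2])
  have "[\<chi> (a * b) = a ^ ((p - 1) div 2) * b ^ ((p - 1) div 2)] (mod int p)"
    using e[of "a * b"] by (simp add: power_mult_distrib)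
  also have "[a ^ ((p - 1) div 2) * b ^ ((p - 1) div 2) = \<chi> a * \<chi> b] (mod int p)"
    by (intro cong_mult cong_sym[OF e])
  finally show "[\<chi> (a * b) = \<chi> a * \<chi> b] (mod int p)" .
  have "\<chi> a \<in> {-1, 0, 1}" "\<chi> b \<in> {-1, 0, 1}" by (simp_all add: Legendre_def)
  then show "\<chi> a * \<chi> b \<in> {-1, 0, 1}" by auto
qed

lemma chi_square: "\<not> int p dvd a \<Longrightarrow> \<chi> (a * a) = 1"
  using chi_cases[of a] by (auto simp: chi_mult)

lemma chi_minus_1: "\<chi> (- 1) = (- 1) ^ ((p - 1) div 2)"
proof (rule chi_eqI)
  show "[\<chi> (- 1) = (- 1) ^ ((p - 1) div 2)] (mod int p)"
    by (rule euler_criterion[OF prime_p p_gt_2])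
qed (simp add: minus_one_power_iff)

lemma chi_1: "\<chi> 1 = 1"
  using chi_mult[of 1 1] chi_cases[of 1] prime_int_p not_prime_unit by force

lemma chi_minus: "\<chi> (- a) = \<chi> (- 1) * \<chi> a"
  using chi_mult[of "- 1" a] by simp

definition units :: "int set" where "units = {1..int p - 1}"
definition squares :: "int set" where "squares = {t \<in> units. \<chi> t = 1}"
definition nonsquares :: "int set" where "nonsquares = {t \<in> units. \<chi> t = - 1}"

lemma finite_units: "finite units" and finite_squares: "finite squares"
  and finite_nonsquares: "finite nonsquares"
  by (auto simp: units_def squares_def nonsquares_def intro: finite_subset[of _ "{1..int p - 1}"])

lemma units_not_dvd: "t \<in> units \<Longrightarrow> \<not> int p dvd t"
  by (auto simp: units_def dest: zdvd_imp_le)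

lemma units_inj: "t \<in> units \<Longrightarrow> t' \<in> units \<Longrightarrow> int p dvd t - t' \<Longrightarrow> t = t'"
  by (rule eq_if_dvd_diff_small) (auto simp: units_def)

lemma mod_in_units: "\<not> int p dvd a \<Longrightarrow> a mod int p \<in> units"
proof -
  assume "\<not> int p dvd a"
  moreover have "0 \<le> a mod int p" "a mod int p < int p" using p_gt_2 by simp_all
  ultimately show ?thesis by (auto simp: units_def dvd_eq_mod_eq_0)
qed

lemma chi_mod: "\<chi> (a mod int p) = \<chi> a"
  by (rule chi_cong) (simp flip: mod_eq_dvd_iff)

lemma card_units_split: "card squares + card nonsquares = p - 1"
proof -
  have "squares \<union> nonsquares = units"
    using chi_cases units_not_dvd by (auto simp: squares_def nonsquares_def)
  moreover have "squares \<inter> nonsquares = {}" by (auto simp: squares_def nonsquares_def)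
  ultimately have "card units = card squares + card nonsquares"
    using card_Un_disjoint[OF finite_squares finite_nonsquares] by simp
  then show ?thesis using p_gt_2 by (simp add: units_def nat_diff_distrib)
qed

lemma mult_mod_inj_on: "\<not> int p dvd r \<Longrightarrow> inj_on (\<lambda>t. (r * t) mod int p) units"
proof (rule inj_onI)
  fix t t' assume r: "\<not> int p dvd r" and *: "t \<in> units" "t' \<in> units" "(r * t) mod int p = (r * t') mod int p"
  have "int p dvd r * (t - t')" using *(3) by (simp add: mod_eq_dvd_iff algebra_simps)
  then have "int p dvd t - t'" using r prime_dvd_multD[OF prime_int_p] by blast
  then show "t = t'" using * units_inj by blast
qed

text \<open>The residues z and p - z have the same square, so the roots can be taken from the lower
  half.\<close>

lemma card_squares_le: "card squares \<le> (p - 1) div 2"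
proof -
  define h where "h = int ((p - 1) div 2)"
  have ph: "int p = 2 * h + 1" using odd_p p_gt_2 by (auto simp: h_def elim!: oddE)
  have "squares \<subseteq> (\<lambda>y. y\<^sup>2 mod int p) ` {1..h}"
  proof
    fix t assume t: "t \<in> squares"
    then have "QuadRes (int p) t" using units_not_dvd
      by (auto simp: squares_def Legendre_def cong_0_iff split: if_splits)
    then obtain y where y: "[y\<^sup>2 = t] (mod int p)" by (auto simp: QuadRes_def)
    have tm: "t = y\<^sup>2 mod int p" using y t by (auto simp: squares_def units_def cong_def)
    define z where "z = y mod int p"
    have tz: "t = z\<^sup>2 mod int p" by (simp add: tm z_def power_mod)
    have "\<not> int p dvd z"
      using t tz units_not_dvd by (auto simp: squares_def units_def power2_eq_square dvd_eq_mod_eq_0)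
    then have "z mod int p \<in> units" by (rule mod_in_units)
    then have z: "z \<in> units" by (simp add: z_def)
    show "t \<in> (\<lambda>y. y\<^sup>2 mod int p) ` {1..h}"
    proof (cases "z \<le> h")
      case True
      then show ?thesis using z tz by (auto simp: units_def)
    next
      case False
      have "(int p - z)\<^sup>2 = z\<^sup>2 + int p * (int p - 2 * z)" by (simp add: power2_eq_square algebra_simps)
      then have "(int p - z)\<^sup>2 mod int p = t" using tz by simp
      moreover have "int p - z \<in> {1..h}" using False z ph by (auto simp: units_def)
      ultimately show ?thesis by blast
    qed
  qed
  then have "card squares \<le> card {1..h}" by (meson finite_atLeastAtMost_int surj_card_le)
  then show ?thesis by (simp add: h_def)
qed

text \<open>By the upper bound there is a nonsquare, and multiplication by it injects the nonsquares
  into the squares.\<close>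

lemma card_squares: "card squares = (p - 1) div 2"
  and card_nonsquares: "card nonsquares = (p - 1) div 2"
proof -
  have "card nonsquares > 0" using card_squares_le card_units_split p_gt_2 by linarith
  then obtain r where r: "r \<in> nonsquares" by (metis card.empty ex_in_conv less_nat_zero_code)
  have nr: "\<not> int p dvd r" using r units_not_dvd by (simp add: nonsquares_def)
  have "(\<lambda>t. (r * t) mod int p) ` nonsquares \<subseteq> squares"
  proof (rule image_subsetI)
    fix t assume t: "t \<in> nonsquares"
    have "\<not> int p dvd r * t" using nr t units_not_dvd prime_dvd_multD[OF prime_int_p]
      by (auto simp: nonsquares_def)
    then show "(r * t) mod int p \<in> squares"
      using r t mod_in_units by (simp add: squares_def nonsquares_def chi_mod chi_mult)
  qed
  moreover have "inj_on (\<lambda>t. (r * t) mod int p) nonsquares"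
    by (rule inj_on_subset[OF mult_mod_inj_on[OF nr]]) (auto simp: nonsquares_def)
  ultimately have "card nonsquares \<le> card squares"
    using card_inj_on_le finite_squares by blast
  then show "card squares = (p - 1) div 2" "card nonsquares = (p - 1) div 2"
    using card_squares_le card_units_split by linarith+
qed

end

section \<open>Relative packings over primes\<close>

context odd_prime
begin

text \<open>Multiplication by a square preserves the character. Two positions with the same label
  have opposite signs, so their developed differences lie in different classes. The (p - 1) / 2
  squares turn 2w blocks into the required w (p - 1).\<close>

lemma rel_packable_sign_template:
  assumes S: "sign_template (int w) \<sigma> Bs"
    and chi: "\<And>b i j. (b, i, j) \<in> set (template_positions Bs) \<Longrightarrow>
      \<chi> (\<rho> (snd (snd b ! i)) - \<rho> (snd (snd b ! j)))
        = (if \<sigma> (snd (snd b ! i)) (snd (snd b ! j)) then 1 else - 1)"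
    and c4: "length (filter (\<lambda>b. length (snd b) = 4) Bs) = 2 * w"
    and c5: "length (filter (\<lambda>b. length (snd b) = 5) Bs) = 2 * w"
  shows "rel_packable w p 1 p"
proof -
  have two: "2 * ((p - 1) div 2) = p - 1" using odd_p by simp
  have "packable (modlat 4 8 \<times> modlat w p) (- (UNIV \<times> modlat 1 p)) (w * (p - 1))"
  proof (rule packable_template[where \<rho> = \<rho> and T = "\<lambda>_. squares" and Bs = Bs])
    show "prime p" by (rule prime_p)
    show "well_sized Bs" using S by (simp add: sign_template_def)
    show "finite squares" by (rule finite_squares)
    show "(\<Sum>b\<leftarrow>filter (\<lambda>b. length (snd b) = 4) Bs. card squares) = w * (p - 1)"
      "(\<Sum>b\<leftarrow>filter (\<lambda>b. length (snd b) = 5) Bs. card squares) = w * (p - 1)"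
      using two by (simp_all add: sum_list_triv c4 c5 card_squares)
  next
    fix t t' assume "t \<in> squares" "t' \<in> squares" "int p dvd t - t'"
    then show "t = t'" using units_inj by (simp add: squares_def)
  next
    fix t assume "t \<in> squares" then show "\<not> int p dvd t" using units_not_dvd by (simp add: squares_def)
  next
    fix b i j assume "(b, i, j) \<in> set (template_positions Bs)"
    then show "\<not> int p dvd \<rho> (snd (snd b ! i)) - \<rho> (snd (snd b ! j))"
      unfolding chi_eq_0_iff[symmetric] by (simp add: chi)
  next
    fix b i j c k l t t'
    assume pos: "(b, i, j) \<in> set (template_positions Bs)" "(c, k, l) \<in> set (template_positions Bs)"
      and *: "(b, i, j) \<noteq> (c, k, l)" "position_label (int w) (b, i, j) = position_label (int w) (c, k, l)"
      and t: "t \<in> squares" "t' \<in> squares"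
    let ?d = "\<rho> (snd (snd b ! i)) - \<rho> (snd (snd b ! j))"
    let ?e = "\<rho> (snd (snd c ! k)) - \<rho> (snd (snd c ! l))"
    have "\<chi> ?d \<noteq> \<chi> ?e"
      unfolding chi[OF pos(1)] chi[OF pos(2)] using sign_templateD[OF S pos *] by auto
    moreover have "\<chi> (?d * t) = \<chi> ?d" "\<chi> (?e * t') = \<chi> ?e"
      using t by (simp_all only: chi_mult squares_def mem_Collect_eq mult_1_right)
    ultimately show "\<not> int p dvd ?d * t - ?e * t'" using chi_cong by metis
  qed
  moreover have "w * p - (w div 1) * (p div p) = w * (p - 1)"
    using p_gt_2 by (simp add: diff_mult_distrib2)
  ultimately show ?thesis by (simp add: rel_packable_def)
qed

text \<open>The blocks are written along a transitive subtournament of the Paley tournament.\<close>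

lemma rel_packable_ordered:
  assumes p3: "p mod 4 = 3" and "p \<ge> 16"
    and S: "sign_template (int w) (\<lambda>i j. j < i) (map (\<lambda>B. ((), zip B [0..<5])) Bs)"
    and c: "length (filter (\<lambda>b. length (snd b) = 4) (map (\<lambda>B. ((), zip B [0..<5])) Bs)) = 2 * w"
      "length (filter (\<lambda>b. length (snd b) = 5) (map (\<lambda>B. ((), zip B [0..<5])) Bs)) = 2 * w"
  shows "rel_packable w p 1 p"
proof -
  have "odd ((p - 1) div 2)" using p3 by presburger
  then have m1: "\<chi> (- 1) = - 1" by (simp add: chi_minus_1)
  let ?V = "{0..<int p}"
  \<comment> \<open>As -1 is a nonsquare, exactly one of x - y and y - x is a square, which makes
    this a tournament. Five vertices in transitive order are guaranteed by \<open>2 ^ 4\<close>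
    vertices; hence the bound 16.\<close>
  have "\<exists>xs. length xs = Suc 4 \<and> set xs \<subseteq> ?V \<and> sorted_wrt (\<lambda>x y. \<chi> (y - x) = 1) xs"
  proof (rule transitive_subtournament)
    fix x y :: int assume "x \<in> ?V" "y \<in> ?V" "x \<noteq> y"
    then have "\<not> int p dvd y - x" using eq_if_dvd_diff_small[of y x] by fastforce
    then show "\<chi> (y - x) = 1 \<or> \<chi> (x - y) = 1"
      using chi_cases[of "y - x"] chi_minus[of "y - x"] m1 by auto
  qed (use \<open>p \<ge> 16\<close> in simp_all)
  then obtain xs where xs: "length xs = 5" "sorted_wrt (\<lambda>x y. \<chi> (y - x) = 1) xs" by auto
  have less: "\<chi> (xs ! i - xs ! j) = 1" if "j < i" "i < 5" for i j
    using sorted_wrt_nth_less[OF xs(2) that(1)] that(2) xs(1) by simp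
  \<comment> \<open>The rows number the points of a block; a block of size 4 uses the first
    four.\<close>
  let ?Bs = "map (\<lambda>B. ((), zip B [0..<5])) Bs"
  show ?thesis
  proof (rule rel_packable_sign_template[OF S _ c])
    fix b i j assume pos: "(b, i, j) \<in> set (template_positions ?Bs)"
    then obtain B where B: "B \<in> set Bs" "b = ((), zip B [0..<5])" by (auto simp: mem_template_positions)
    have ij: "i < length B" "j < length B" "i < 5" "j < 5" "i \<noteq> j"
      using pos by (auto simp: mem_template_positions B(2))
    have "snd (snd b ! i) = i" "snd (snd b ! j) = j" using ij by (simp_all add: B(2))
    moreover have "\<chi> (xs ! i - xs ! j) = (if j < i then 1 else - 1)"
    proof (cases "j < i")
      case False
      then have "\<chi> (xs ! j - xs ! i) = 1" using ij by (intro less) simp_all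
      then show ?thesis using False chi_minus[of "xs ! j - xs ! i"] m1 by simp
    qed (use less ij in simp)
    ultimately show "\<chi> ((!) xs (snd (snd b ! i)) - (!) xs (snd (snd b ! j)))
        = (if snd (snd b ! j) < snd (snd b ! i) then 1 else - 1)" by simp
  qed
qed

end

text \<open>For p = 7 and p = 11 the Paley tournament has no transitive subtournament on five
  vertices: a vertex beats only three others for 7, and for 11 it beats five, each of which beats
  just two of the rest. So the rows are explicit residues that vary from block to block.\<close>

lemma rel_packable_7:
  fixes Bs :: "(label \<times> int) list list"
  assumes S: "sign_template (int w) (\<lambda>r r'. (r - r') mod 7 \<in> {1, 2, 4}) (map (Pair ()) Bs)"
    and nz: "list_all (\<lambda>(b, i, j). (snd (snd b ! i) - snd (snd b ! j)) mod 7 \<noteq> 0)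
      (template_positions (map (Pair ()) Bs))"
    and c: "length (filter (\<lambda>b. length (snd b) = 4) (map (Pair ()) Bs)) = 2 * w"
      "length (filter (\<lambda>b. length (snd b) = 5) (map (Pair ()) Bs)) = 2 * w"
  shows "rel_packable w 7 1 7"
proof -
  interpret odd_prime 7 by standard simp_all
  have m1: "\<chi> (- 1) = - 1" by (simp add: chi_minus_1[simplified])
  have sq: "\<chi> (x * x) = 1" if "\<not> 7 dvd x" for x using chi_square[of x] that by simp
  have res: "\<chi> 1 = 1" "\<chi> 2 = 1" "\<chi> 4 = 1"
    using chi_1 sq[of 3] sq[of 2] chi_cong[of 2 9] by simp_all
  have nonres: "\<chi> 3 = - 1" "\<chi> 5 = - 1" "\<chi> 6 = - 1"
    using chi_cong[of 3 "- 4"] chi_cong[of 5 "- 2"] chi_cong[of 6 "- 1"] chi_minus[of 4] chi_minus[of 2]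
      res m1 by simp_all
  have chi7: "\<chi> d = (if d mod 7 \<in> {1, 2, 4} then 1 else - 1)" if "d mod 7 \<noteq> 0" for d
  proof -
    have "0 \<le> d mod 7" "d mod 7 < 7" by simp_all
    then have "d mod 7 \<in> {1, 2, 3, 4, 5, 6}" using that by (simp, presburger)
    then show ?thesis using chi_mod[of d] res nonres by auto
  qed
  show ?thesis
  proof (rule rel_packable_sign_template[OF S _ c, where \<rho> = "\<lambda>r :: int. r"])
    fix b i j assume pos: "(b, i, j) \<in> set (template_positions (map (Pair ()) Bs))"
    have "(snd (snd b ! i) - snd (snd b ! j)) mod 7 \<noteq> 0"
      using bspec[OF nz[unfolded list_all_iff] pos] by (simp only: prod.case not_False_eq_True)
    from chi7[OF this]
    show "\<chi> (snd (snd b ! i) - snd (snd b ! j))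
      = (if (snd (snd b ! i) - snd (snd b ! j)) mod 7 \<in> {1, 2, 4} then 1 else - 1)" .
  qed
qed

lemma rel_packable_11:
  fixes Bs :: "(label \<times> int) list list"
  assumes S: "sign_template (int w) (\<lambda>r r'. (r - r') mod 11 \<in> {1, 3, 4, 5, 9}) (map (Pair ()) Bs)"
    and nz: "list_all (\<lambda>(b, i, j). (snd (snd b ! i) - snd (snd b ! j)) mod 11 \<noteq> 0)
      (template_positions (map (Pair ()) Bs))"
    and c: "length (filter (\<lambda>b. length (snd b) = 4) (map (Pair ()) Bs)) = 2 * w"
      "length (filter (\<lambda>b. length (snd b) = 5) (map (Pair ()) Bs)) = 2 * w"
  shows "rel_packable w 11 1 11"
proof -
  interpret odd_prime 11 by standard simp_all
  have m1: "\<chi> (- 1) = - 1" by (simp add: chi_minus_1[simplified])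
  have sq: "\<chi> (x * x) = 1" if "\<not> 11 dvd x" for x using chi_square[of x] that by simp
  have res: "\<chi> 1 = 1" "\<chi> 3 = 1" "\<chi> 4 = 1" "\<chi> 5 = 1" "\<chi> 9 = 1"
    using chi_1 sq[of 5] sq[of 2] sq[of 4] sq[of 3] chi_cong[of 3 25] chi_cong[of 5 16] by simp_all
  have nonres: "\<chi> 2 = - 1" "\<chi> 6 = - 1" "\<chi> 7 = - 1" "\<chi> 8 = - 1" "\<chi> 10 = - 1"
    using chi_cong[of 2 "- 9"] chi_cong[of 6 "- 5"] chi_cong[of 7 "- 4"] chi_cong[of 8 "- 3"]
      chi_cong[of 10 "- 1"] chi_minus[of 9] chi_minus[of 5] chi_minus[of 4] chi_minus[of 3]
      res m1 by simp_all
  have chi11: "\<chi> d = (if d mod 11 \<in> {1, 3, 4, 5, 9} then 1 else - 1)" if "d mod 11 \<noteq> 0" for d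
  proof -
    have "0 \<le> d mod 11" "d mod 11 < 11" by simp_all
    then have "d mod 11 \<in> {1, 2, 3, 4, 5, 6, 7, 8, 9, 10}" using that by (simp, presburger)
    then show ?thesis using chi_mod[of d] res nonres by auto
  qed
  show ?thesis
  proof (rule rel_packable_sign_template[OF S _ c, where \<rho> = "\<lambda>r :: int. r"])
    fix b i j assume pos: "(b, i, j) \<in> set (template_positions (map (Pair ()) Bs))"
    have "(snd (snd b ! i) - snd (snd b ! j)) mod 11 \<noteq> 0"
      using bspec[OF nz[unfolded list_all_iff] pos] by (simp only: prod.case not_False_eq_True)
    from chi11[OF this]
    show "\<chi> (snd (snd b ! i) - snd (snd b ! j))
      = (if (snd (snd b ! i) - snd (snd b ! j)) mod 11 \<in> {1, 3, 4, 5, 9} then 1 else - 1)" .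
  qed
qed

section \<open>Templates for primes congruent to 1 modulo 4\<close>

datatype multiplier_range = Quarter | Half | Full

text \<open>A row code \<open>(a, b)\<close> stands for \<open>a + b * s\<close>, where \<open>s\<close> and \<open>s - 1\<close> are nonsquares and \<open>s + 1\<close> is a
  square. The class \<open>(k, e)\<close> of a difference of codes means that its quadratic character is \<open>e\<close>
  times that of \<open>k\<close>; \<open>k = 0\<close> marks an unknown character.\<close>

fun chi_class :: "int \<times> int \<Rightarrow> int \<times> int" where
  "chi_class (a, b) =
     (if b = 0 then (\<bar>a\<bar>, 1)
      else if a = 0 then (\<bar>b\<bar>, - 1)
      else if \<bar>a\<bar> = 1 \<and> a = b then (1, 1)
      else if \<bar>a\<bar> = 1 \<and> a = - b then (1, - 1)
      else (0, 0))"

declare chi_class.simps [simp del]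

text \<open>A \<open>Full\<close> position uses every unit, so no other position may share its
  label. The other multipliers are squares, and opposite characters keep the products apart. Two
  \<open>Quarter\<close> positions may also have opposite differences, because their multipliers
  represent the squares up to sign.\<close>

fun compatible :: "multiplier_range \<times> int \<times> int \<Rightarrow> multiplier_range \<times> int \<times> int \<Rightarrow> bool" where
  "compatible (c, a, b) (c', a', b') \<longleftrightarrow> c \<noteq> Full \<and> c' \<noteq> Full \<and>
     (c = Quarter \<and> c' = Quarter \<and> a' = - a \<and> b' = - b \<or>
      fst (chi_class (a, b)) = fst (chi_class (a', b')) \<and>
      snd (chi_class (a, b)) = - snd (chi_class (a', b')))"

definition position_code ::
    "(multiplier_range \<times> (label \<times> (int \<times> int)) list) \<times> nat \<times> nat \<Rightarrow> multiplier_range \<times> int \<times> int" where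
  "position_code = (\<lambda>(b, i, j). (fst b, snd (snd b ! i) - snd (snd b ! j)))"

text \<open>A class with first component 1 to 4 makes the difference a unit, as p >= 5. The
  characters of 2 and 3 depend on p, so only differences with the same first component are compared.
  \<open>sorted_wrt\<close> visits each unordered pair of positions once.\<close>

definition character_template ::
    "int \<Rightarrow> (multiplier_range \<times> (label \<times> (int \<times> int)) list) list \<Rightarrow> bool" where
  "character_template w Bs \<longleftrightarrow> well_sized Bs \<and>
     (let xs = map (\<lambda>P. (position_label w P, position_code P)) (template_positions Bs)
      in list_all (\<lambda>x. fst (chi_class (snd (snd x))) \<in> {1, 2, 3, 4}) xs \<and>
         sorted_wrt (\<lambda>x y. fst x = fst y \<longrightarrow> compatible (snd x) (snd y)) xs)"

lemma sorted_wrt_distinct_memb: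
  assumes "sorted_wrt R xs" and "x \<in> set xs" and "y \<in> set xs" and "x \<noteq> y"
  shows "R x y \<or> R y x"
  using assms by (induction xs) (simp, metis set_ConsD sorted_wrt.simps(2))

context odd_prime
begin

text \<open>Representatives of the squares up to sign when -1 is a square.\<close>

definition half_squares :: "int set" where "half_squares = {t \<in> squares. 2 * t < int p}"

lemma half_squares_subset: "half_squares \<subseteq> squares"
  by (auto simp: half_squares_def)

lemma half_squares_add:
  assumes "t \<in> half_squares" and "t' \<in> half_squares"
  shows "\<not> int p dvd t + t'"
proof
  assume "int p dvd t + t'"
  moreover have "0 < t + t'" "2 * t < int p" "2 * t' < int p"
    using assms by (simp_all add: half_squares_def squares_def units_def)
  ultimately show False using zdvd_imp_le[of "int p" "t + t'"] by linarith
qed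

text \<open>As -1 is a square, the map from t to p - t exchanges the lower and the upper half of the
  squares.\<close>

lemma card_half_squares:
  assumes "\<chi> (- 1) = 1"
  shows "2 * card half_squares = card squares"
proof -
  have bij: "bij_betw (\<lambda>t. int p - t) half_squares (squares - half_squares)"
  proof (rule bij_betw_byWitness[where f' = "\<lambda>t. int p - t"])
    have neg: "int p - t \<in> squares" if "t \<in> squares" for t
    proof -
      have "\<chi> (int p - t) = \<chi> (- t)" by (rule chi_cong) simp
      then show ?thesis using that assms chi_minus[of t] by (auto simp: squares_def units_def)
    qed
    show "(\<lambda>t. int p - t) ` (squares - half_squares) \<subseteq> half_squares"
    proof (rule image_subsetI)
      fix t assume t: "t \<in> squares - half_squares"
      have "2 * t \<noteq> int p" using odd_p by presburger
      then have "2 * (int p - t) < int p" using t by (auto simp: half_squares_def)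
      then show "int p - t \<in> half_squares" using neg t by (simp add: half_squares_def)
    qed
    show "(\<lambda>t. int p - t) ` half_squares \<subseteq> squares - half_squares"
    proof (rule image_subsetI)
      fix t assume t: "t \<in> half_squares"
      then have "\<not> 2 * (int p - t) < int p" by (simp add: half_squares_def)
      then show "int p - t \<in> squares - half_squares" using neg t by (simp add: half_squares_def)
    qed
  qed simp_all
  have "card squares = card half_squares + card (squares - half_squares)"
    using card_Un_disjoint[of half_squares "squares - half_squares"] half_squares_subset finite_squares
    by (simp add: finite_subset Un_absorb1 Un_Diff_cancel)
  then show ?thesis using bij_betw_same_card[OF bij] by simp
qed

text \<open>If no two nonsquares were adjacent, then \<open>n \<mapsto> n + 1\<close> would inject the nonsquares into the
  squares other than \<open>1\<close>, which are too few.\<close>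

lemma exists_nonsquare_pair_before_square:
  assumes m1: "\<chi> (- 1) = 1"
  obtains s where "\<chi> s = - 1" "\<chi> (s - 1) = - 1" "\<chi> (s + 1) = 1"
proof -
  have last: "\<chi> (int p - 1) = 1" using chi_cong[of "int p - 1" "- 1"] m1 by simp
  \<comment> \<open>The last unit p - 1 is a square, so the successor of a nonsquare is never
    p.\<close>
  have succ: "n + 1 \<in> units" if "n \<in> nonsquares" for n
    using that last by (cases "n = int p - 1") (auto simp: nonsquares_def units_def)
  define M where "M = {n \<in> nonsquares. n + 1 \<in> nonsquares}"
  have "M \<noteq> {}"
  proof
    assume "M = {}"
    have "(\<lambda>n. n + 1) ` nonsquares \<subseteq> squares - {1}"
    proof (rule image_subsetI)
      fix n assume n: "n \<in> nonsquares"
      then have "n + 1 \<notin> nonsquares" using \<open>M = {}\<close> by (simp add: M_def)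
      then have "n + 1 \<in> squares"
        using succ[OF n] chi_cases[OF units_not_dvd[OF succ[OF n]]] by (simp add: nonsquares_def squares_def)
      then show "n + 1 \<in> squares - {1}" using n by (simp add: nonsquares_def units_def)
    qed
    then have "card nonsquares \<le> card (squares - {1})"
      by (intro card_inj_on_le[of "\<lambda>n. n + 1"]) (auto simp: finite_squares)
    moreover have "1 \<in> squares" using p_gt_2 by (simp add: squares_def units_def chi_1)
    then have "card (squares - {1}) < card squares" by (intro psubset_card_mono finite_squares) auto
    ultimately show False by (simp add: card_squares card_nonsquares)
  qed
  moreover have "finite M" using finite_nonsquares by (auto simp: M_def)
  \<comment> \<open>For the last pair of adjacent nonsquares, the next number must be a
    square.\<close>
  ultimately have n: "Max M \<in> M" and max: "\<And>m. m \<in> M \<Longrightarrow> m \<le> Max M" by simp_all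
  let ?s = "Max M + 1"
  have s: "?s \<in> nonsquares" "Max M \<in> nonsquares" using n by (auto simp: M_def)
  have "?s \<notin> M" using max[of ?s] by auto
  then have "?s + 1 \<notin> nonsquares" using s by (simp add: M_def)
  then have "\<chi> (?s + 1) = 1"
    using succ[OF s(1)] chi_cases[OF units_not_dvd[OF succ[OF s(1)]]] by (simp add: nonsquares_def)
  then show ?thesis using s by (intro that[of ?s]) (simp_all add: nonsquares_def)
qed

end

context odd_prime
begin

text \<open>With the rows 0, 1, -1, s, -s the differences up to sign are 1 and s, 2 and 2s, s - 1
  and s + 1: three pairs of opposite characters, whatever the character of 2 is. Signs do not affect
  characters because -1 is a square.\<close>

lemma rel_packable_character_template:
  assumes m1: "\<chi> (- 1) = 1" and p5: "p \<ge> 5"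
    and C: "character_template (int w) Bs"
    and c4: "(\<Sum>b\<leftarrow>filter (\<lambda>b. length (snd b) = 4) Bs.
      case fst b of Quarter \<Rightarrow> 1 | Half \<Rightarrow> 2 | Full \<Rightarrow> 4) = 4 * w"
    and c5: "(\<Sum>b\<leftarrow>filter (\<lambda>b. length (snd b) = 5) Bs.
      case fst b of Quarter \<Rightarrow> 1 | Half \<Rightarrow> 2 | Full \<Rightarrow> 4) = 4 * w"
  shows "rel_packable w p 1 p"
proof -
  obtain s where s: "\<chi> s = - 1" "\<chi> (s - 1) = - 1" "\<chi> (s + 1) = 1"
    using exists_nonsquare_pair_before_square[OF m1] .
  define \<rho> where "\<rho> = (\<lambda>(a, b). a + b * s)"
  have \<rho>_diff: "\<rho> x - \<rho> y = \<rho> (x - y)" for x y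
    by (cases x; cases y) (simp add: \<rho>_def algebra_simps)
  define T where "T = (\<lambda>c. case c of Quarter \<Rightarrow> half_squares | Half \<Rightarrow> squares | Full \<Rightarrow> units)"
  have neg: "\<chi> (- a) = \<chi> a" for a using chi_minus[of a] m1 by simp
  have abs: "\<chi> \<bar>a\<bar> = \<chi> a" for a using neg[of a] by (simp add: abs_if)
  have small: "\<not> int p dvd k" if "k \<in> {1, 2, 3, 4}" for k
    using that p5 zdvd_imp_le[of "int p" k] by auto
  have chi_\<rho>: "\<chi> (\<rho> d) = snd (chi_class d) * \<chi> (fst (chi_class d))"
    if cls: "fst (chi_class d) \<in> {1, 2, 3, 4}" for d
  proof -
    obtain a b where d: "d = (a, b)" by (cases d)
    consider "b = 0" | "b \<noteq> 0" "a = 0" | "b \<noteq> 0" "a \<noteq> 0" "\<bar>a\<bar> = 1" "a = b"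
      | "b \<noteq> 0" "a \<noteq> 0" "\<bar>a\<bar> = 1" "a = - b" "a \<noteq> b"
      using cls unfolding d chi_class.simps by (auto split: if_splits)
    then show ?thesis
    proof cases
      case 1 then show ?thesis by (simp add: d \<rho>_def abs chi_class.simps)
    next
      case 2 then show ?thesis by (simp add: d \<rho>_def abs chi_mult s chi_class.simps)
    next
      case 3
      then have "\<rho> d = s + 1 \<or> \<rho> d = - (s + 1)" by (auto simp: d \<rho>_def abs_if split: if_splits)
      then have "\<chi> (\<rho> d) = 1" using s(3) neg[of "s + 1"] by auto
      then show ?thesis using 3 by (simp add: d chi_1 chi_class.simps)
    next
      case 4
      then have "\<rho> d = s - 1 \<or> \<rho> d = - (s - 1)" by (auto simp: d \<rho>_def abs_if split: if_splits)
      then have "\<chi> (\<rho> d) = - 1" using s(2) neg[of "s - 1"] by auto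
      then show ?thesis using 4 by (simp add: d chi_1 chi_class.simps)
    qed
  qed
  have snd_class: "snd (chi_class d) \<in> {- 1, 1}" if "fst (chi_class d) \<in> {1, 2, 3, 4}" for d
    using that by (cases d) (auto simp: chi_class.simps split: if_splits)
  have nz: "\<not> int p dvd \<rho> d" if cls: "fst (chi_class d) \<in> {1, 2, 3, 4}" for d
  proof -
    have "\<chi> (fst (chi_class d)) \<noteq> 0" using small[OF cls] unfolding chi_eq_0_iff .
    moreover have "snd (chi_class d) \<noteq> 0" using snd_class[OF cls] by auto
    ultimately have "\<chi> (\<rho> d) \<noteq> 0" unfolding chi_\<rho>[OF cls] by simp
    then show ?thesis unfolding chi_eq_0_iff .
  qed
  have good: "fst (chi_class (snd (position_code P))) \<in> {1, 2, 3, 4}" if "P \<in> set (template_positions Bs)" for P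
    using C that by (auto simp: character_template_def list_all_iff)
  have T_units: "t \<in> units" if "t \<in> T c" for t c
    using that by (cases c) (auto simp: T_def half_squares_def squares_def)
  have T_squares: "\<chi> t = 1" if "t \<in> T c" "c \<noteq> Full" for t c
    using that by (cases c) (auto simp: T_def half_squares_def squares_def)
  have sep: "\<not> int p dvd \<rho> (a, b) * t - \<rho> (a', b') * t'"
    if comp: "compatible (c, a, b) (c', a', b')" and t: "t \<in> T c" "t' \<in> T c'"
      and g: "fst (chi_class (a, b)) \<in> {1, 2, 3, 4}" "fst (chi_class (a', b')) \<in> {1, 2, 3, 4}"
    for c c' a b a' b' t t'
  proof -
    have cc: "c \<noteq> Full" "c' \<noteq> Full" using comp by simp_all
    consider "c = Quarter" "c' = Quarter" "a' = - a" "b' = - b"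
      | "fst (chi_class (a, b)) = fst (chi_class (a', b'))" "snd (chi_class (a, b)) = - snd (chi_class (a', b'))"
      using comp unfolding compatible.simps by blast
    then show ?thesis
    proof cases
      case 1
      \<comment> \<open>Opposite differences could only agree for t = -t', and no two elements of
        \<open>half_squares\<close> are opposite.\<close>
      have e: "\<rho> (a, b) * t - \<rho> (a', b') * t' = \<rho> (a, b) * (t + t')"
        using 1 by (simp add: \<rho>_def algebra_simps)
      have "\<not> int p dvd \<rho> (a, b)" using nz[OF g(1)] .
      moreover have "\<not> int p dvd t + t'" using t half_squares_add by (simp add: 1 T_def)
      ultimately show ?thesis unfolding e using prime_dvd_multD[OF prime_int_p] by blast
    next
      case 2
      have "\<chi> (fst (chi_class (a, b))) \<noteq> 0" using small[OF g(1)] unfolding chi_eq_0_iff .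
      then have ne: "\<chi> (\<rho> (a, b)) \<noteq> \<chi> (\<rho> (a', b'))"
        unfolding chi_\<rho>[OF g(1)] chi_\<rho>[OF g(2)] 2(1)[symmetric] 2(2) using snd_class[OF g(2)] by auto
      have "\<chi> (\<rho> (a, b) * t) = \<chi> (\<rho> (a, b))" "\<chi> (\<rho> (a', b') * t') = \<chi> (\<rho> (a', b'))"
        unfolding chi_mult using T_squares[OF t(1) cc(1)] T_squares[OF t(2) cc(2)] by simp_all
      then show ?thesis using ne chi_cong by metis
    qed
  qed
  \<comment> \<open>This is (p - 1) / 4, the unit in which the weights 1, 2 and 4 of the multiplier
    ranges count.\<close>
  define q where "q = card half_squares"
  have cards: "card squares = 2 * q" "p - 1 = 4 * q"
  proof -
    show "card squares = 2 * q" using card_half_squares[OF m1] by (simp add: q_def)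
    moreover have "2 * ((p - 1) div 2) = p - 1" using odd_p by simp
    ultimately show "p - 1 = 4 * q" using card_squares by linarith
  qed
  have cardT: "card (T c) = q * (case c of Quarter \<Rightarrow> 1 | Half \<Rightarrow> 2 | Full \<Rightarrow> 4)" for c
  proof -
    have "card units = p - 1" using p_gt_2 by (simp add: units_def nat_diff_distrib)
    then show ?thesis using cards by (cases c) (simp_all add: T_def q_def)
  qed
  have "packable (modlat 4 8 \<times> modlat w p) (- (UNIV \<times> modlat 1 p)) (w * (p - 1))"
  proof (rule packable_template[where \<rho> = \<rho> and T = T and Bs = Bs])
    show "prime p" by (rule prime_p)
    show "well_sized Bs" using C by (simp add: character_template_def)
    show "finite (T c)" for c
      using finite_units finite_squares half_squares_subset
      by (cases c) (auto simp: T_def intro: finite_subset)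
    show "(\<Sum>b\<leftarrow>filter (\<lambda>b. length (snd b) = 4) Bs. card (T (fst b))) = w * (p - 1)"
      "(\<Sum>b\<leftarrow>filter (\<lambda>b. length (snd b) = 5) Bs. card (T (fst b))) = w * (p - 1)"
      unfolding cardT sum_list_const_mult c4 c5 cards by simp_all
  next
    fix c t t' assume "t \<in> T c" "t' \<in> T c" "int p dvd t - t'"
    then show "t = t'" using units_inj T_units by blast
  next
    fix c t assume "t \<in> T c" then show "\<not> int p dvd t" using units_not_dvd T_units by blast
  next
    fix b i j assume "(b, i, j) \<in> set (template_positions Bs)"
    then have g: "fst (chi_class (snd (snd b ! i) - snd (snd b ! j))) \<in> {1, 2, 3, 4}"
      using good[of "(b, i, j)"] by (simp add: position_code_def)
    show "\<not> int p dvd \<rho> (snd (snd b ! i)) - \<rho> (snd (snd b ! j))"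
      unfolding \<rho>_diff by (rule nz[OF g])
  next
    fix b i j c k l t t'
    assume pos: "(b, i, j) \<in> set (template_positions Bs)" "(c, k, l) \<in> set (template_positions Bs)"
      and ne: "(b, i, j) \<noteq> (c, k, l)"
      and lab: "position_label (int w) (b, i, j) = position_label (int w) (c, k, l)"
      and t: "t \<in> T (fst b)" "t' \<in> T (fst c)"
    obtain a1 a2 where a: "snd (snd b ! i) - snd (snd b ! j) = (a1, a2)" by (metis surj_pair)
    obtain b1 b2 where b: "snd (snd c ! k) - snd (snd c ! l) = (b1, b2)" by (metis surj_pair)
    have code: "position_code (b, i, j) = (fst b, a1, a2)" "position_code (c, k, l) = (fst c, b1, b2)"
      by (simp_all add: position_code_def a b)
    have g: "fst (chi_class (a1, a2)) \<in> {1, 2, 3, 4}" "fst (chi_class (b1, b2)) \<in> {1, 2, 3, 4}"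
      using good[OF pos(1)] good[OF pos(2)] unfolding code by simp_all
    have "sorted_wrt (\<lambda>P Q. position_label (int w) P = position_label (int w) Q \<longrightarrow>
        compatible (position_code P) (position_code Q)) (template_positions Bs)"
      using C by (simp add: character_template_def sorted_wrt_map Let_def)
    from sorted_wrt_distinct_memb[OF this pos ne]
    have "compatible (fst b, a1, a2) (fst c, b1, b2) \<or> compatible (fst c, b1, b2) (fst b, a1, a2)"
      using lab code by auto
    then show "\<not> int p dvd (\<rho> (snd (snd b ! i)) - \<rho> (snd (snd b ! j))) * t -
        (\<rho> (snd (snd c ! k)) - \<rho> (snd (snd c ! l))) * t'"
      unfolding \<rho>_diff a b using sep[OF _ t g] sep[OF _ t(2,1) g(2,1)] dvd_diff_commute by metis
  qed
  moreover have "w * p - (w div 1) * (p div p) = w * (p - 1)"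
    using p_gt_2 by (simp add: diff_mult_distrib2)
  ultimately show ?thesis by (simp add: rel_packable_def)
qed

end

section \<open>Template data and the relative packings over primes p >= 5\<close>

definition ordered_1 :: "label list list" where
  "ordered_1 = [
    [((0,0),0), ((0,4),0), ((0,3),0), ((2,0),0)],
    [((0,0),0), ((1,5),0), ((3,7),0), ((0,5),0)],
    [((0,0),0), ((3,1),0), ((1,7),0), ((1,0),0), ((0,2),0)],
    [((0,0),0), ((1,3),0), ((3,6),0), ((3,4),0), ((0,0),0)]]"

definition ordered_3 :: "label list list" where
  "ordered_3 = [
    [((0,0),0), ((0,2),0), ((2,1),0), ((2,0),0)],
    [((0,0),0), ((2,4),1), ((2,7),2), ((1,2),2)],
    [((0,0),0), ((0,1),1), ((0,4),0), ((3,3),2)],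
    [((0,0),0), ((0,3),0), ((3,3),1), ((0,1),2)],
    [((0,0),0), ((0,0),2), ((1,7),2), ((0,4),1)],
    [((0,0),0), ((0,2),1), ((1,5),0), ((1,3),0)],
    [((0,0),0), ((1,2),0), ((2,2),1), ((1,2),1), ((0,0),0)],
    [((0,0),0), ((3,4),0), ((2,5),0), ((3,5),0), ((1,6),2)],
    [((0,0),0), ((2,3),0), ((2,1),1), ((0,7),2), ((1,5),2)],
    [((0,0),0), ((2,3),1), ((0,7),1), ((1,0),2), ((3,7),0)],
    [((0,0),0), ((2,3),2), ((2,0),1), ((2,5),1), ((3,4),2)],
    [((0,0),0), ((3,1),1), ((1,3),1), ((2,0),2), ((0,5),1)]]"

definition template_7_1 :: "(label \<times> int) list list" where
  "template_7_1 = [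
    [(((0,0),0),0), (((0,4),0),1), (((1,3),0),2), (((2,0),0),3)],
    [(((0,0),0),0), (((0,2),0),3), (((1,6),0),1), (((2,5),0),4)],
    [(((0,0),0),0), (((3,7),0),1), (((0,5),0),6), (((0,3),0),5), (((1,0),0),4)],
    [(((0,0),0),0), (((0,0),0),5), (((0,7),0),1), (((3,6),0),4), (((2,6),0),6)]]"

definition template_7_3 :: "(label \<times> int) list list" where
  "template_7_3 = [
    [(((0,0),0),0), (((0,0),0),1), (((0,3),2),4), (((3,3),2),3)],
    [(((0,0),0),0), (((0,1),1),3), (((1,7),1),6), (((2,4),1),5)],
    [(((0,0),0),0), (((0,2),0),3), (((1,1),2),1), (((2,7),1),6)],
    [(((0,0),0),0), (((0,0),1),3), (((1,5),0),4), (((2,0),1),1)],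
    [(((0,0),0),0), (((0,2),1),1), (((2,1),0),2), (((2,6),2),5)],
    [(((0,0),0),0), (((0,2),0),1), (((0,4),1),4), (((2,4),0),6)],
    [(((0,0),0),0), (((2,2),1),3), (((1,0),0),5), (((1,2),2),1), (((1,1),0),2)],
    [(((0,0),0),0), (((3,7),2),4), (((3,0),2),2), (((0,3),1),3), (((0,2),2),1)],
    [(((0,0),0),0), (((1,1),2),3), (((1,1),0),5), (((0,3),0),1), (((2,5),2),2)],
    [(((0,0),0),0), (((3,5),2),1), (((2,5),0),2), (((0,4),1),3), (((3,2),2),5)],
    [(((0,0),0),0), (((2,7),2),5), (((1,7),1),1), (((3,1),0),6), (((2,3),2),3)],
    [(((0,0),0),0), (((3,1),0),1), (((1,3),0),3), (((1,4),1),5), (((2,7),0),4)]]"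

definition template_11_1 :: "(label \<times> int) list list" where
  "template_11_1 = [
    [(((0,0),0),0), (((0,2),0),1), (((1,4),0),3), (((2,6),0),4)],
    [(((0,0),0),0), (((0,1),0),1), (((0,4),0),2), (((3,3),0),10)],
    [(((0,0),0),0), (((0,0),0),4), (((2,1),0),1), (((3,0),0),3), (((1,3),0),7)],
    [(((0,0),0),0), (((1,1),0),7), (((3,1),0),2), (((3,4),0),9), (((3,3),0),1)]]"

definition template_11_3 :: "(label \<times> int) list list" where
  "template_11_3 = [
    [(((0,0),0),0), (((0,0),0),1), (((0,0),1),2), (((1,4),1),9)],
    [(((0,0),0),0), (((0,3),2),1), (((1,3),0),2), (((2,2),0),5)],
    [(((0,0),0),0), (((0,2),0),1), (((0,4),1),4), (((2,3),0),5)],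
    [(((0,0),0),0), (((0,2),0),2), (((1,0),2),3), (((2,2),1),1)],
    [(((0,0),0),0), (((0,1),0),2), (((0,2),2),3), (((1,1),1),10)],
    [(((0,0),0),0), (((0,2),2),2), (((0,5),0),1), (((2,4),0),4)],
    [(((0,0),0),0), (((1,2),1),4), (((2,0),2),6), (((0,4),1),8), (((1,3),2),9)],
    [(((0,0),0),0), (((1,2),1),10), (((1,3),1),2), (((0,1),1),6), (((2,6),0),1)],
    [(((0,0),0),0), (((1,1),0),2), (((2,0),0),4), (((3,5),2),6), (((2,3),2),1)],
    [(((0,0),0),0), (((3,7),1),1), (((1,0),0),2), (((0,3),0),4), (((2,1),1),3)],
    [(((0,0),0),0), (((1,5),1),1), (((2,5),0),9), (((0,2),1),7), (((3,3),2),4)],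
    [(((0,0),0),0), (((1,7),1),6), (((2,5),2),4), (((1,4),0),1), (((1,0),0),3)]]"

text \<open>A \<open>Quarter\<close> block has labels 0, h, k, k + h with 2h = 0 and rows 1, -1, s,
  -s. Adding h to the labels and negating the rows fixes it, so the multipliers t and -t would give
  the same differences, and one of them is taken. The four blocks use the four solutions h; the
  label h is exhausted by the differences 2, -2, 2s and -2s.\<close>

definition character_template_1 :: "(multiplier_range \<times> (label \<times> (int \<times> int)) list) list" where
  "character_template_1 = [
    (Quarter, [(((0,0),0),(1,0)), (((0,0),0),(-1,0)), (((1,7),0),(0,1)), (((1,7),0),(0,-1))]),
    (Quarter, [(((0,0),0),(1,0)), (((0,4),0),(-1,0)), (((1,2),0),(0,1)), (((1,6),0),(0,-1))]),
    (Quarter, [(((0,0),0),(1,0)), (((2,0),0),(-1,0)), (((2,3),0),(0,1)), (((0,3),0),(0,-1))]),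
    (Quarter, [(((0,0),0),(1,0)), (((2,4),0),(-1,0)), (((2,2),0),(0,1)), (((0,6),0),(0,-1))]),
    (Half, [(((0,0),0),(0,0)), (((1,0),0),(1,0)), (((3,7),0),(-1,0)), (((0,2),0),(0,1)), (((0,3),0),(0,-1))]),
    (Half, [(((0,0),0),(0,0)), (((2,2),0),(1,0)), (((2,3),0),(-1,0)), (((3,7),0),(0,1)), (((1,0),0),(0,-1))])]"

text \<open>The \<open>Quarter\<close> blocks have the same symmetry as in
  \<open>character_template_1\<close>. In the \<open>Full\<close> blocks the rows are 0, 1, 2, 3
  and, for size 5, also 4, and each label is used by one position only.\<close>

definition character_template_3 :: "(multiplier_range \<times> (label \<times> (int \<times> int)) list) list" where
  "character_template_3 = [
    (Quarter, [(((0,0),0),(1,0)), (((0,0),0),(-1,0)), (((0,2),1),(0,1)), (((0,2),1),(0,-1))]),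
    (Quarter, [(((0,0),0),(1,0)), (((0,4),0),(-1,0)), (((1,1),1),(0,1)), (((1,5),1),(0,-1))]),
    (Quarter, [(((0,0),0),(1,0)), (((2,0),0),(-1,0)), (((1,5),1),(0,1)), (((3,5),1),(0,-1))]),
    (Quarter, [(((0,0),0),(1,0)), (((2,4),0),(-1,0)), (((3,5),1),(0,1)), (((1,1),1),(0,-1))]),
    (Full, [(((0,0),0),(0,0)), (((0,0),1),(1,0)), (((1,0),0),(2,0)), (((1,7),2),(3,0))]),
    (Full, [(((0,0),0),(0,0)), (((0,2),2),(1,0)), (((1,5),2),(2,0)), (((2,5),0),(3,0))]),
    (Full, [(((0,0),0),(0,0)), (((0,7),1),(1,0)), (((2,7),0),(2,0)), (((0,3),2),(3,0)), (((1,5),0),(4,0))]),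
    (Full, [(((0,0),0),(0,0)), (((1,7),0),(1,0)), (((1,4),0),(2,0)), (((3,5),2),(3,0)), (((1,6),0),(4,0))]),
    (Full, [(((0,0),0),(0,0)), (((1,1),2),(1,0)), (((1,6),1),(2,0)), (((2,2),2),(3,0)), (((3,4),1),(4,0))])]"

lemma ordered_templates:
  "sign_template 1 (\<lambda>i j. j < i) (map (\<lambda>B. ((), zip B [0..<5])) ordered_1)"
  "sign_template 3 (\<lambda>i j. j < i) (map (\<lambda>B. ((), zip B [0..<5])) ordered_3)"
  by code_simp+

lemma templates_7:
  "sign_template 1 (\<lambda>r r'. (r - r') mod 7 \<in> {1, 2, 4}) (map (Pair ()) template_7_1)"
  "sign_template 3 (\<lambda>r r'. (r - r') mod 7 \<in> {1, 2, 4}) (map (Pair ()) template_7_3)"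
  "list_all (\<lambda>(b, i, j). (snd (snd b ! i) - snd (snd b ! j)) mod 7 \<noteq> 0)
     (template_positions (map (Pair ()) template_7_1))"
  "list_all (\<lambda>(b, i, j). (snd (snd b ! i) - snd (snd b ! j)) mod 7 \<noteq> 0)
     (template_positions (map (Pair ()) template_7_3))"
  by code_simp+

lemma templates_11:
  "sign_template 1 (\<lambda>r r'. (r - r') mod 11 \<in> {1, 3, 4, 5, 9}) (map (Pair ()) template_11_1)"
  "sign_template 3 (\<lambda>r r'. (r - r') mod 11 \<in> {1, 3, 4, 5, 9}) (map (Pair ()) template_11_3)"
  "list_all (\<lambda>(b, i, j). (snd (snd b ! i) - snd (snd b ! j)) mod 11 \<noteq> 0)
     (template_positions (map (Pair ()) template_11_1))"
  "list_all (\<lambda>(b, i, j). (snd (snd b ! i) - snd (snd b ! j)) mod 11 \<noteq> 0)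
     (template_positions (map (Pair ()) template_11_3))"
  by code_simp+

lemma character_templates:
  "character_template 1 character_template_1" "character_template 3 character_template_3"
  by code_simp+

lemma rel_packable_prime:
  assumes p: "prime p" "p \<ge> 5" and w: "w = 1 \<or> w = 3"
  shows "rel_packable w p 1 p"
proof -
  interpret odd_prime p using p by unfold_locales simp_all
  have "odd p" by (rule odd_p)
  then consider "p mod 4 = 1" | "p mod 4 = 3" "p \<ge> 16" | "p = 7" | "p = 11"
  proof -
    assume *: "p mod 4 = 1 \<Longrightarrow> thesis" "p mod 4 = 3 \<Longrightarrow> 16 \<le> p \<Longrightarrow> thesis" "p = 7 \<Longrightarrow> thesis" "p = 11 \<Longrightarrow> thesis"
    show thesis
    proof (cases "p mod 4 = 1 \<or> p \<ge> 16")
      case True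
      moreover have "p mod 4 = 1 \<or> p mod 4 = 3" using \<open>odd p\<close> by presburger
      ultimately show ?thesis using * by blast
    next
      case False
      then have "p = 7 \<or> p = 11 \<or> p = 15" using p(2) \<open>odd p\<close> by presburger
      moreover have "\<not> prime (15 :: nat)" by simp
      ultimately show ?thesis using * p(1) by blast
    qed
  qed
  then show ?thesis
  proof cases
    case 1
    then have "even ((p - 1) div 2)" by presburger
    then have m1: "\<chi> (- 1) = 1" by (simp add: chi_minus_1)
    show ?thesis
      using w rel_packable_character_template[OF m1 p(2), of 1 character_template_1]
        rel_packable_character_template[OF m1 p(2), of 3 character_template_3] character_templates
      by (auto simp: character_template_1_def character_template_3_def)
  next
    case 2
    then show ?thesis
      using w rel_packable_ordered[of 1 ordered_1] rel_packable_ordered[of 3 ordered_3] ordered_templates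
      by (auto simp: ordered_1_def ordered_3_def)
  next
    case 3
    then show ?thesis
      using w rel_packable_7[of 1 template_7_1] rel_packable_7[of 3 template_7_3] templates_7
      by (auto simp: template_7_1_def template_7_3_def)
  next
    case 4
    then show ?thesis
      using w rel_packable_11[of 1 template_11_1] rel_packable_11[of 3 template_11_3] templates_11
      by (auto simp: template_11_1_def template_11_3_def)
  qed
qed

section \<open>Packing data for the prime 3\<close>

definition blocks_9 :: "point list list" where
  "blocks_9 = [
    [((0,0),(0,0)), ((0,1),(5,0)), ((1,2),(2,0)), ((1,5),(8,0))],
    [((0,0),(0,0)), ((0,4),(4,0)), ((1,2),(1,0)), ((3,7),(7,0))],
    [((0,0),(0,0)), ((0,1),(3,0)), ((1,1),(5,0)), ((1,3),(2,0))],
    [((0,0),(0,0)), ((0,2),(7,0)), ((1,4),(1,0)), ((3,3),(5,0))],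
    [((0,0),(0,0)), ((0,1),(2,0)), ((0,3),(7,0)), ((2,2),(8,0))],
    [((0,0),(0,0)), ((0,0),(2,0)), ((0,0),(5,0)), ((2,0),(4,0))],
    [((0,0),(0,0)), ((0,1),(1,0)), ((1,3),(5,0)), ((3,2),(2,0))],
    [((0,0),(0,0)), ((0,3),(8,0)), ((1,3),(6,0)), ((1,7),(5,0))],
    [((0,0),(0,0)), ((3,1),(6,0)), ((2,3),(1,0)), ((2,1),(2,0)), ((2,5),(4,0))],
    [((0,0),(0,0)), ((2,3),(6,0)), ((2,5),(1,0)), ((2,2),(7,0)), ((3,3),(2,0))],
    [((0,0),(0,0)), ((0,3),(1,0)), ((1,6),(2,0)), ((2,3),(7,0)), ((3,7),(6,0))],
    [((0,0),(0,0)), ((1,7),(1,0)), ((3,3),(8,0)), ((2,6),(5,0)), ((0,1),(7,0))],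
    [((0,0),(0,0)), ((3,0),(6,0)), ((2,3),(4,0)), ((2,4),(1,0)), ((3,5),(2,0))],
    [((0,0),(0,0)), ((0,1),(4,0)), ((2,7),(8,0)), ((0,5),(7,0)), ((1,0),(1,0))],
    [((0,0),(0,0)), ((1,3),(4,0)), ((3,5),(1,0)), ((2,4),(3,0)), ((0,3),(5,0))],
    [((0,0),(0,0)), ((0,2),(1,0)), ((0,0),(8,0)), ((3,6),(3,0)), ((2,6),(6,0))]]"

text \<open>Negating the last two coordinates turns each block of size 4 into a translate of itself
  and exchanges the blocks of size 5 in consecutive pairs.\<close>

definition blocks_27 :: "point list list" where
  "blocks_27 = [
    [((0,0),(3,0)), ((2,0),(24,0)), ((1,2),(7,0)), ((3,2),(20,0))],
    [((0,0),(3,0)), ((2,4),(24,0)), ((2,2),(5,0)), ((0,6),(22,0))],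
    [((0,0),(5,0)), ((2,0),(22,0)), ((0,2),(11,0)), ((2,2),(16,0))],
    [((0,0),(11,0)), ((0,0),(16,0)), ((1,4),(12,0)), ((1,4),(15,0))],
    [((0,0),(1,0)), ((2,0),(26,0)), ((1,0),(2,0)), ((3,0),(25,0))],
    [((0,0),(7,0)), ((0,4),(20,0)), ((1,0),(12,0)), ((1,4),(15,0))],
    [((0,0),(4,0)), ((0,4),(23,0)), ((1,5),(10,0)), ((1,1),(17,0))],
    [((0,0),(10,0)), ((2,0),(17,0)), ((1,3),(12,0)), ((3,3),(15,0))],
    [((0,0),(6,0)), ((2,0),(21,0)), ((1,7),(13,0)), ((3,7),(14,0))],
    [((0,0),(4,0)), ((2,0),(23,0)), ((1,7),(8,0)), ((3,7),(19,0))],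
    [((0,0),(3,0)), ((0,4),(24,0)), ((1,7),(5,0)), ((1,3),(22,0))],
    [((0,0),(1,0)), ((0,4),(26,0)), ((1,7),(2,0)), ((1,3),(25,0))],
    [((0,0),(5,0)), ((0,0),(22,0)), ((1,3),(10,0)), ((1,3),(17,0))],
    [((0,0),(1,0)), ((0,0),(26,0)), ((0,3),(3,0)), ((0,3),(24,0))],
    [((0,0),(7,0)), ((0,0),(20,0)), ((0,3),(13,0)), ((0,3),(14,0))],
    [((0,0),(8,0)), ((0,4),(19,0)), ((0,3),(13,0)), ((0,7),(14,0))],
    [((0,0),(4,0)), ((0,0),(23,0)), ((2,1),(6,0)), ((2,1),(21,0))],
    [((0,0),(6,0)), ((0,4),(21,0)), ((0,1),(11,0)), ((0,5),(16,0))],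
    [((0,0),(2,0)), ((0,0),(25,0)), ((2,3),(8,0)), ((2,3),(19,0))],
    [((0,0),(1,0)), ((2,4),(26,0)), ((1,7),(12,0)), ((3,3),(15,0))],
    [((0,0),(4,0)), ((2,4),(23,0)), ((1,5),(8,0)), ((3,1),(19,0))],
    [((0,0),(2,0)), ((2,4),(25,0)), ((2,3),(6,0)), ((0,7),(21,0))],
    [((0,0),(11,0)), ((2,4),(16,0)), ((2,3),(13,0)), ((0,7),(14,0))],
    [((0,0),(7,0)), ((2,4),(20,0)), ((2,3),(10,0)), ((0,7),(17,0))],
    [((0,0),(0,0)), ((3,7),(16,0)), ((2,5),(19,0)), ((0,7),(23,0)), ((3,5),(4,0))],
    [((0,0),(0,0)), ((3,7),(11,0)), ((2,5),(8,0)), ((0,7),(4,0)), ((3,5),(23,0))],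
    [((0,0),(0,0)), ((1,5),(10,0)), ((2,6),(14,0)), ((1,7),(17,0)), ((2,7),(21,0))],
    [((0,0),(0,0)), ((1,5),(17,0)), ((2,6),(13,0)), ((1,7),(10,0)), ((2,7),(6,0))],
    [((0,0),(0,0)), ((1,7),(19,0)), ((0,3),(12,0)), ((3,2),(5,0)), ((2,1),(7,0))],
    [((0,0),(0,0)), ((1,7),(8,0)), ((0,3),(15,0)), ((3,2),(22,0)), ((2,1),(20,0))],
    [((0,0),(0,0)), ((3,7),(3,0)), ((2,3),(15,0)), ((3,5),(14,0)), ((1,2),(25,0))],
    [((0,0),(0,0)), ((3,7),(24,0)), ((2,3),(12,0)), ((3,5),(13,0)), ((1,2),(2,0))],
    [((0,0),(0,0)), ((1,3),(7,0)), ((3,4),(3,0)), ((3,2),(6,0)), ((2,6),(17,0))],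
    [((0,0),(0,0)), ((1,3),(20,0)), ((3,4),(24,0)), ((3,2),(21,0)), ((2,6),(10,0))],
    [((0,0),(0,0)), ((3,1),(13,0)), ((3,0),(25,0)), ((0,3),(26,0)), ((1,2),(5,0))],
    [((0,0),(0,0)), ((3,1),(14,0)), ((3,0),(2,0)), ((0,3),(1,0)), ((1,2),(22,0))],
    [((0,0),(0,0)), ((0,3),(11,0)), ((0,6),(14,0)), ((1,3),(21,0)), ((0,1),(1,0))],
    [((0,0),(0,0)), ((0,3),(16,0)), ((0,6),(13,0)), ((1,3),(6,0)), ((0,1),(26,0))],
    [((0,0),(0,0)), ((3,0),(21,0)), ((1,6),(2,0)), ((3,7),(5,0)), ((2,2),(24,0))],
    [((0,0),(0,0)), ((3,0),(6,0)), ((1,6),(25,0)), ((3,7),(22,0)), ((2,2),(3,0))],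
    [((0,0),(0,0)), ((2,1),(22,0)), ((1,5),(16,0)), ((3,3),(1,0)), ((2,3),(20,0))],
    [((0,0),(0,0)), ((2,1),(5,0)), ((1,5),(11,0)), ((3,3),(26,0)), ((2,3),(7,0))],
    [((0,0),(0,0)), ((0,6),(26,0)), ((3,6),(10,0)), ((2,7),(15,0)), ((3,0),(14,0))],
    [((0,0),(0,0)), ((0,6),(1,0)), ((3,6),(17,0)), ((2,7),(12,0)), ((3,0),(13,0))],
    [((0,0),(0,0)), ((1,6),(20,0)), ((2,7),(14,0)), ((2,2),(6,0)), ((1,4),(25,0))],
    [((0,0),(0,0)), ((1,6),(7,0)), ((2,7),(13,0)), ((2,2),(21,0)), ((1,4),(2,0))],
    [((0,0),(0,0)), ((1,6),(16,0)), ((3,4),(17,0)), ((0,1),(14,0)), ((3,3),(15,0))],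
    [((0,0),(0,0)), ((1,6),(11,0)), ((3,4),(10,0)), ((0,1),(13,0)), ((3,3),(12,0))]]"

text \<open>The data have the same symmetry as \<open>blocks_27\<close>.\<close>

definition blocks_3_9 :: "point list list" where
  "blocks_3_9 = [
    [((0,0),(1,5)), ((0,0),(2,4)), ((0,2),(1,7)), ((0,2),(2,2))],
    [((0,0),(0,1)), ((2,4),(0,8)), ((1,7),(1,5)), ((3,3),(2,4))],
    [((0,0),(0,1)), ((0,0),(0,8)), ((2,2),(1,2)), ((2,2),(2,7))],
    [((0,0),(0,1)), ((2,0),(0,8)), ((1,1),(1,5)), ((3,1),(2,4))],
    [((0,0),(1,0)), ((2,0),(2,0)), ((1,7),(1,2)), ((3,7),(2,7))],
    [((0,0),(1,0)), ((0,4),(2,0)), ((1,7),(1,5)), ((1,3),(2,4))],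
    [((0,0),(0,2)), ((0,0),(0,7)), ((0,1),(1,0)), ((0,1),(2,0))],
    [((0,0),(0,4)), ((2,0),(0,5)), ((1,0),(1,7)), ((3,0),(2,2))],
    [((0,0),(0,4)), ((0,0),(0,5)), ((2,1),(1,1)), ((2,1),(2,8))],
    [((0,0),(1,4)), ((0,0),(2,5)), ((1,0),(1,6)), ((1,0),(2,3))],
    [((0,0),(1,3)), ((0,0),(2,6)), ((2,1),(1,8)), ((2,1),(2,1))],
    [((0,0),(1,3)), ((0,4),(2,6)), ((0,1),(1,4)), ((0,5),(2,5))],
    [((0,0),(1,1)), ((2,0),(2,8)), ((0,3),(1,3)), ((2,3),(2,6))],
    [((0,0),(1,6)), ((2,4),(2,3)), ((1,2),(1,8)), ((3,6),(2,1))],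
    [((0,0),(1,0)), ((2,4),(2,0)), ((1,4),(1,4)), ((3,0),(2,5))],
    [((0,0),(0,2)), ((2,4),(0,7)), ((1,0),(1,3)), ((3,4),(2,6))],
    [((0,0),(0,1)), ((0,4),(0,8)), ((1,4),(1,8)), ((1,0),(2,1))],
    [((0,0),(0,2)), ((2,0),(0,7)), ((0,3),(1,8)), ((2,3),(2,1))],
    [((0,0),(1,4)), ((2,0),(2,5)), ((2,1),(1,6)), ((0,1),(2,3))],
    [((0,0),(1,1)), ((2,4),(2,8)), ((1,2),(1,2)), ((3,6),(2,7))],
    [((0,0),(1,1)), ((0,4),(2,8)), ((1,6),(1,6)), ((1,2),(2,3))],
    [((0,0),(0,4)), ((2,4),(0,5)), ((1,6),(1,7)), ((3,2),(2,2))],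
    [((0,0),(0,4)), ((0,4),(0,5)), ((2,3),(1,7)), ((2,7),(2,2))],
    [((0,0),(0,2)), ((0,4),(0,7)), ((2,3),(1,2)), ((2,7),(2,7))],
    [((0,0),(0,0)), ((0,6),(1,8)), ((1,1),(1,3)), ((1,3),(2,1)), ((0,7),(0,4))],
    [((0,0),(0,0)), ((0,6),(2,1)), ((1,1),(2,6)), ((1,3),(1,8)), ((0,7),(0,5))],
    [((0,0),(0,0)), ((3,7),(2,8)), ((3,4),(1,8)), ((2,2),(2,0)), ((1,5),(0,5))],
    [((0,0),(0,0)), ((3,7),(1,1)), ((3,4),(2,1)), ((2,2),(1,0)), ((1,5),(0,4))],
    [((0,0),(0,0)), ((3,4),(0,8)), ((3,6),(0,4)), ((2,3),(2,2)), ((2,2),(1,8))],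
    [((0,0),(0,0)), ((3,4),(0,1)), ((3,6),(0,5)), ((2,3),(1,7)), ((2,2),(2,1))],
    [((0,0),(0,0)), ((1,1),(0,5)), ((3,0),(0,4)), ((1,3),(2,0)), ((0,6),(2,7))],
    [((0,0),(0,0)), ((1,1),(0,4)), ((3,0),(0,5)), ((1,3),(1,0)), ((0,6),(1,2))],
    [((0,0),(0,0)), ((3,2),(1,7)), ((3,7),(0,8)), ((2,7),(2,1)), ((3,5),(2,8))],
    [((0,0),(0,0)), ((3,2),(2,2)), ((3,7),(0,1)), ((2,7),(1,8)), ((3,5),(1,1))],
    [((0,0),(0,0)), ((3,7),(1,0)), ((2,5),(0,2)), ((3,2),(1,1)), ((2,3),(2,1))],
    [((0,0),(0,0)), ((3,7),(2,0)), ((2,5),(0,7)), ((3,2),(2,8)), ((2,3),(1,8))],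
    [((0,0),(0,0)), ((2,7),(2,0)), ((3,0),(1,4)), ((1,6),(0,8)), ((2,5),(1,6))],
    [((0,0),(0,0)), ((2,7),(1,0)), ((3,0),(2,5)), ((1,6),(0,1)), ((2,5),(2,3))],
    [((0,0),(0,0)), ((1,6),(2,0)), ((1,5),(1,0)), ((1,3),(2,4)), ((0,1),(0,7))],
    [((0,0),(0,0)), ((1,6),(1,0)), ((1,5),(2,0)), ((1,3),(1,5)), ((0,1),(0,2))],
    [((0,0),(0,0)), ((1,4),(1,0)), ((1,7),(2,4)), ((1,6),(1,8)), ((0,3),(1,7))],
    [((0,0),(0,0)), ((1,4),(2,0)), ((1,7),(1,5)), ((1,6),(2,1)), ((0,3),(2,2))],
    [((0,0),(0,0)), ((2,3),(1,2)), ((1,5),(2,6)), ((2,2),(0,1)), ((3,3),(2,8))],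
    [((0,0),(0,0)), ((2,3),(2,7)), ((1,5),(1,3)), ((2,2),(0,8)), ((3,3),(1,1))],
    [((0,0),(0,0)), ((0,5),(1,5)), ((2,7),(1,1)), ((1,0),(0,8)), ((3,6),(2,4))],
    [((0,0),(0,0)), ((0,5),(2,4)), ((2,7),(2,8)), ((1,0),(0,1)), ((3,6),(1,5))],
    [((0,0),(0,0)), ((0,3),(2,6)), ((2,5),(0,8)), ((2,6),(2,2)), ((3,4),(0,7))],
    [((0,0),(0,0)), ((0,3),(1,3)), ((2,5),(0,1)), ((2,6),(1,7)), ((3,4),(0,2))]]"

definition blocks_3_3 :: "point list list" where
  "blocks_3_3 = [
    [((0,0),(0,0)), ((0,2),(0,1)), ((1,1),(1,2)), ((1,7),(2,1))],
    [((0,0),(0,0)), ((0,1),(2,1)), ((0,4),(0,2)), ((3,7),(2,2))],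
    [((0,0),(0,0)), ((0,0),(1,1)), ((1,6),(2,1)), ((3,2),(2,2))],
    [((0,0),(0,0)), ((0,1),(2,2)), ((1,2),(2,0)), ((3,7),(0,1))],
    [((0,0),(0,0)), ((0,1),(1,1)), ((1,1),(2,0)), ((3,6),(2,1))],
    [((0,0),(0,0)), ((1,0),(1,0)), ((2,0),(0,1)), ((3,5),(2,0))],
    [((0,0),(0,0)), ((0,2),(2,0)), ((1,1),(2,2)), ((2,0),(1,1))],
    [((0,0),(0,0)), ((0,3),(2,0)), ((1,6),(0,1)), ((3,5),(2,1))],
    [((0,0),(0,0)), ((1,4),(2,2)), ((2,2),(0,1)), ((1,3),(2,1)), ((2,5),(0,2))],
    [((0,0),(0,0)), ((3,1),(2,1)), ((0,1),(0,2)), ((2,7),(1,1)), ((0,4),(2,0))],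
    [((0,0),(0,0)), ((0,1),(2,0)), ((0,3),(0,2)), ((0,1),(1,0)), ((2,3),(1,2))],
    [((0,0),(0,0)), ((1,2),(0,1)), ((2,0),(2,1)), ((3,3),(2,2)), ((2,6),(1,0))],
    [((0,0),(0,0)), ((2,2),(1,0)), ((0,5),(2,1)), ((0,1),(1,2)), ((2,2),(1,1))],
    [((0,0),(0,0)), ((2,4),(1,2)), ((3,3),(0,2)), ((2,7),(2,2)), ((3,0),(1,0))],
    [((0,0),(0,0)), ((2,7),(1,0)), ((0,6),(0,1)), ((3,3),(1,2)), ((3,1),(0,2))],
    [((0,0),(0,0)), ((3,4),(2,2)), ((2,4),(2,0)), ((3,0),(1,1)), ((0,0),(1,2))]]"

definition blocks_3 :: "point list list" where
  "blocks_3 = [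
    [((0,0),(0,0)), ((3,3),(0,0)), ((2,0),(2,0)), ((1,6),(0,0))],
    [((0,0),(0,0)), ((1,2),(0,0)), ((2,3),(2,0)), ((1,7),(0,0))],
    [((0,0),(0,0)), ((2,4),(1,0)), ((0,6),(1,0)), ((0,5),(2,0)), ((2,7),(0,0))],
    [((0,0),(0,0)), ((0,4),(1,0)), ((3,4),(0,0)), ((1,6),(2,0)), ((0,2),(1,0))]]"

text \<open>No packing relative to \<open>Z_4 x Z_8\<close> exists here, since two of four points
  agree modulo 3. The blocks therefore also use differences inside that subgroup.\<close>

lemma optimal_packable_3: "optimal_packable 3 1"
proof -
  have "explicit_packing (residue_key 3 1) 2 blocks_3" by code_simp
  then have E: "explicit_packing (residue_key (int 3) (int 1)) 2 blocks_3" by simp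
  have "packable (modlat 4 8 \<times> modlat 3 1) UNIV 2"
    by (rule packable_explicit[OF E residue_key_eq]) simp_all
  then show ?thesis by (simp add: optimal_packable_def)
qed

lemma rel_packable_9: "rel_packable 9 1 9 1"
proof -
  have "explicit_packing (residue_key 9 1) 8 blocks_9" "avoids_hole 9 1 blocks_9" by code_simp+
  then show ?thesis by (intro rel_packable_explicit[where n = 8 and Bs = blocks_9]) simp_all
qed

lemma rel_packable_3_3: "rel_packable 3 3 3 3"
proof -
  have "explicit_packing (residue_key 3 3) 8 blocks_3_3" "avoids_hole 3 3 blocks_3_3" by code_simp+
  then show ?thesis by (intro rel_packable_explicit[where n = 8 and Bs = blocks_3_3]) simp_all
qed

lemma rel_packable_27: "rel_packable 27 1 9 1"
proof -
  have "explicit_packing (residue_key 27 1) 24 blocks_27" "avoids_hole 9 1 blocks_27" by code_simp+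
  then show ?thesis by (intro rel_packable_explicit[where n = 24 and Bs = blocks_27]) simp_all
qed

lemma rel_packable_3_9: "rel_packable 3 9 3 3"
proof -
  have "explicit_packing (residue_key 3 9) 24 blocks_3_9" "avoids_hole 3 3 blocks_3_9" by code_simp+
  then show ?thesis by (intro rel_packable_explicit[where n = 24 and Bs = blocks_3_9]) simp_all
qed

section \<open>Induction on the orders\<close>

lemma optimal_packable_step:
  assumes R: "rel_packable u v r s" and D: "dmatrix_exists x y"
    and O: "optimal_packable ((u div r) * x) ((v div s) * y)"
    and pos: "u > 0" "v > 0" "x > 0" "y > 0"
  shows "optimal_packable (u * x) (v * y)"
proof (rule optimal_packable_fill)
  show "rel_packable (u * x) (v * y) r s" by (rule rel_packable_lift[OF R D pos(1,2)])
  have "r dvd u" "s dvd v" using R by (simp_all add: rel_packable_def)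
  then show "optimal_packable (u * x div r) (v * y div s)"
    using O by (simp add: div_mult_swap mult.commute)
qed (use pos in simp_all)

text \<open>By Chinese remaindering, (x, y) maps to p x + w y. This moves p into the first cyclic
  factor, for the case that p divides the first order.\<close>

lemma rel_packable_merge:
  assumes R: "rel_packable w p 1 p" and "coprime w p" and pos: "w > 0" "p > 0"
  shows "rel_packable (w * p) 1 p 1"
proof -
  have "packable (modlat 4 8 \<times> modlat w p) (- (UNIV \<times> modlat 1 p)) (w * p - w)"
    using R pos by (simp add: rel_packable_def)
  then have "packable (modlat 4 8 \<times> modlat (w * p) 1) (- (UNIV \<times> modlat p 1)) (w * p - w)"
  proof (rule packable_hom[where h = "\<lambda>(k, (x, y)). (k, (int p * x + int w * y, 0))"])
    fix k :: point
    obtain a b x y where k: "k = ((a, b), (x, y))" by (metis surj_pair)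
    have cop: "coprime (int w) (int p)" using assms(2) by simp
    {
      assume "(\<lambda>(k, (x, y)). (k, (int p * x + int w * y, 0))) k \<in> modlat 4 8 \<times> modlat (w * p) 1"
      then have h: "int 4 dvd a" "int 8 dvd b" "int w * int p dvd int p * x + int w * y" by (simp_all add: k)
      have "int w dvd int p * x + int w * y" "int p dvd int p * x + int w * y"
        using h(3) by (auto dest: dvd_mult_left dvd_mult_right)
      then have "int w dvd int p * x" "int p dvd int w * y"
        by (simp_all add: dvd_add_left_iff dvd_add_right_iff)
      then have "int w dvd x" "int p dvd y"
        using cop by (simp_all add: coprime_dvd_mult_right_iff coprime_commute)
      then show "k \<in> modlat 4 8 \<times> modlat w p" using h by (simp add: k)
    }
    {
      assume "k \<in> - (UNIV \<times> modlat 1 p)"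
      then have "\<not> int p dvd y" by (simp add: k)
      then have "\<not> int p dvd int p * x + int w * y"
        using cop by (simp add: dvd_add_right_iff coprime_dvd_mult_right_iff coprime_commute)
      then show "(\<lambda>(k, (x, y)). (k, (int p * x + int w * y, 0))) k \<in> - (UNIV \<times> modlat p 1)"
        by (simp add: k)
    }
  qed (auto simp: algebra_simps)
  then show ?thesis using pos by (simp add: rel_packable_def)
qed

text \<open>One prime p is removed from \<open>m * n\<close>; what remains of \<open>m * n\<close>
  is the order of the kernel and is prime to 6. The factor \<open>w\<close> stays in the base, and
  the recursion ends at the orders 1 and 3.\<close>

lemma optimal_packable_coprime_6:
  assumes "coprime (m * n) 6" and "m > 0" "n > 0" and w: "w = 1 \<or> w = 3"
  shows "optimal_packable (w * m) n"
  using assms(1-3)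
proof (induction "m * n" arbitrary: m n rule: less_induct)
  case less
  show ?case
  proof (cases "m * n = 1")
    case True
    then show ?thesis using w optimal_packable_1 optimal_packable_3 by auto
  next
    case False
    then obtain p where p: "prime p" "p dvd m * n" using prime_factor_nat by blast
    have "coprime p 6" using less.prems(1) p(2) coprime_divisors[of p "m * n" 6 6] by simp
    have "\<not> p dvd 6"
    proof
      assume "p dvd 6"
      from coprime_common_divisor[OF \<open>coprime p 6\<close> dvd_refl this] show False using p(1) by simp
    qed
    then have "p \<noteq> 2" "p \<noteq> 3" by auto
    moreover have "p \<noteq> 4" using p(1) by auto
    moreover have "p \<ge> 2" using p(1) by (rule prime_ge_2_nat)
    ultimately have p5: "p \<ge> 5" by linarith
    have R: "rel_packable w p 1 p" by (rule rel_packable_prime[OF p(1) p5 w])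
    consider n' where "n = p * n'" | m' where "m = p * m'"
      using p prime_dvd_mult_iff by (metis dvd_def)
    then show ?thesis
    proof cases
      case 1
      have c: "coprime (m * n') 6" using less.prems(1) by (simp add: 1 coprime_mult_left_iff)
      have pos: "n' > 0" using less.prems 1 by simp
      have "optimal_packable (w * m) n'"
        using less.prems pos p5 c by (intro less.hyps) (simp_all add: 1)
      then have "optimal_packable (w * m) (p * n')"
        using optimal_packable_step[OF R dmatrix_exists_coprime_6[OF c less.prems(2) pos]] w less.prems p5 pos
        by auto
      then show ?thesis by (simp add: 1)
    next
      case 2
      have c: "coprime (m' * n) 6" using less.prems(1) by (simp add: 2 coprime_mult_left_iff)
      have pos: "m' > 0" using less.prems 2 by simp
      have IH: "optimal_packable (w * m') n"
        using less.prems pos p5 c by (intro less.hyps) (simp_all add: 2)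
      have "coprime w p" using w p(1) p5 primes_coprime[of 3 p] by auto
      then have R': "rel_packable (w * p) 1 p 1" using rel_packable_merge[OF R] w p5 by auto
      have "optimal_packable (w * p * m') (1 * n)"
        using optimal_packable_step[OF R' dmatrix_exists_coprime_6[OF c pos less.prems(3)]] IH w less.prems p5 pos
        by auto
      then show ?thesis by (simp add: 2 mult.assoc)
    qed
  qed
qed

text \<open>The matrices over \<open>Z_3 x Z_3\<close> and \<open>Z_27\<close> change the exponents
  by (1, 1), (3, 0) or (0, 3), which preserves their difference modulo 3.\<close>

lemma dmatrix_exists_3_powers: "a mod 3 = b mod 3 \<Longrightarrow> dmatrix_exists (3 ^ a) (3 ^ b)"
proof (induction "a + b" arbitrary: a b rule: less_induct)
  case less
  consider "a = 0" "b = 0" | "a \<ge> 1" "b \<ge> 1" | "a = 0" "b \<ge> 3" | "a \<ge> 3" "b = 0"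
    using less.prems by fastforce
  then show ?case
  proof cases
    case 1
    then show ?thesis using dmatrix_exists_coprime_6[of 1 1] by simp
  next
    case 2
    then obtain a' b' where ab: "a = Suc a'" "b = Suc b'" by (metis Suc_le_D One_nat_def)
    have "a' mod 3 = b' mod 3" using less.prems unfolding ab by presburger
    then have "dmatrix_exists (3 ^ a') (3 ^ b')" using less.hyps[of a' b'] ab by simp
    then show ?thesis using dmatrix_exists_mult[OF dmatrix_exists_3_3] by (simp add: ab)
  next
    case 3
    then obtain b' where b: "b = 3 + b'" by (metis le_add_diff_inverse)
    have "a mod 3 = b' mod 3" using less.prems unfolding b by simp
    then have "dmatrix_exists (3 ^ a) (3 ^ b')" using less.hyps[of a b'] b by simp
    then show ?thesis using dmatrix_exists_mult[OF dmatrix_exists_swap[OF dmatrix_exists_27]]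
      by (simp add: b power_add)
  next
    case 4
    then obtain a' where a: "a = 3 + a'" by (metis le_add_diff_inverse)
    have "a' mod 3 = b mod 3" using less.prems unfolding a by simp
    then have "dmatrix_exists (3 ^ a') (3 ^ b)" using less.hyps[of a' b] a by simp
    then show ?thesis using dmatrix_exists_mult[OF dmatrix_exists_27]
      by (simp add: a power_add)
  qed
qed

text \<open>A relative packing is split off so that the exponents left for the kernel agree modulo
  3. If a and b already agree, those over \<open>Z_3 x Z_3\<close> and \<open>Z_27\<close> do this.
  Otherwise, up to an exchange of the factors, a - b is 2 modulo 3, and those over
  \<open>Z_9\<close>, \<open>Z_3 x Z_9\<close> and \<open>Z_81\<close> serve.\<close>

lemma optimal_packable_3_powers:
  assumes "coprime (m * n) 6" and "m > 0" and "n > 0"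
  shows "optimal_packable (3 ^ a * m) (3 ^ b * n)"
  using assms
proof (induction "a + b" arbitrary: a b m n rule: less_induct)
  case less
  have D: "dmatrix_exists (3 ^ c * m) (3 ^ d * n)"
    if "c mod 3 = d mod 3" "coprime (m * n) 6" "m > 0" "n > 0" for c d m n :: nat
    using dmatrix_exists_mult[OF dmatrix_exists_3_powers[OF that(1)] dmatrix_exists_coprime_6[OF that(2-4)]]
    by simp
  have main: "optimal_packable (3 ^ c * m) (3 ^ d * n)"
    if sum: "c + d = a + b" and c: "coprime (m * n) 6" and pos: "m > 0" "n > 0"
      and mod: "c mod 3 = d mod 3 \<or> c mod 3 = (d + 2) mod 3" for c d m n :: nat
  proof -
    have IH: "optimal_packable (3 ^ c' * m) (3 ^ d' * n)" if "c' + d' < c + d" for c' d'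
      using less.hyps[of c' d' m n] that sum c pos by simp
    show ?thesis
    proof (cases "c mod 3 = d mod 3")
      case eq: True
      consider "c = 0" "d = 0" | c' d' where "c = Suc c'" "d = Suc d'"
        | d' where "c = 0" "d = 3 + d'" | c' where "c = 3 + c'" "d = 0"
      proof -
        assume *: "c = 0 \<Longrightarrow> d = 0 \<Longrightarrow> thesis" "\<And>c' d'. c = Suc c' \<Longrightarrow> d = Suc d' \<Longrightarrow> thesis"
          "\<And>d'. c = 0 \<Longrightarrow> d = 3 + d' \<Longrightarrow> thesis" "\<And>c'. c = 3 + c' \<Longrightarrow> d = 0 \<Longrightarrow> thesis"
        have "c = 0 \<and> d = 0 \<or> c \<noteq> 0 \<and> d \<noteq> 0 \<or> c = 0 \<and> d \<ge> 3 \<or> c \<ge> 3 \<and> d = 0" using eq by presburger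
        then show thesis using * by (metis le_add_diff_inverse not0_implies_Suc)
      qed
      then show ?thesis
      proof cases
        case 1
        then show ?thesis using optimal_packable_coprime_6[OF c pos, of 1] by simp
      next
        case 2
        have "c' mod 3 = d' mod 3" using eq unfolding 2 by presburger
        then have "optimal_packable (3 * (3 ^ c' * m)) (3 * (3 ^ d' * n))"
          using optimal_packable_step[OF rel_packable_3_3 D[OF _ c pos]] IH[of c' d'] pos by (simp add: 2)
        then show ?thesis by (simp add: 2 mult.assoc)
      next
        case 3
        \<comment> \<open>The packing over \<open>Z_27\<close> has a hole of order 3 in this factor,
          so the induction hypothesis is used with exponent d' + 1 although the kernel has exponent
          d'.\<close>
        have "0 mod 3 = d' mod 3" using eq unfolding 3 by simp
        then have "optimal_packable (1 * (3 ^ 0 * m)) (27 * (3 ^ d' * n))"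
          using optimal_packable_step[OF rel_packable_swap[OF rel_packable_27] D[OF _ c pos, of 0 d']]
            IH[of 0 "Suc d'"] pos by (simp add: 3 mult.assoc)
        then show ?thesis by (simp add: 3 power_add mult.assoc)
      next
        case 4
        have "c' mod 3 = 0 mod 3" using eq unfolding 4 by simp
        then have "optimal_packable (27 * (3 ^ c' * m)) (1 * (3 ^ 0 * n))"
          using optimal_packable_step[OF rel_packable_27 D[OF _ c pos, of c' 0]]
            IH[of "Suc c'" 0] pos by (simp add: 4 mult.assoc)
        then show ?thesis by (simp add: 4 power_add mult.assoc)
      qed
    next
      case False
      then have eq: "c mod 3 = (d + 2) mod 3" using mod by blast
      consider c' where "c = 2 + c'" | d' where "c = 1" "d = 2 + d'" | "c = 0" "d = 1"
        | d' where "c = 0" "d = 4 + d'"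
      proof -
        assume *: "\<And>c'. c = 2 + c' \<Longrightarrow> thesis" "\<And>d'. c = 1 \<Longrightarrow> d = 2 + d' \<Longrightarrow> thesis"
          "c = 0 \<Longrightarrow> d = 1 \<Longrightarrow> thesis" "\<And>d'. c = 0 \<Longrightarrow> d = 4 + d' \<Longrightarrow> thesis"
        have "c \<ge> 2 \<or> c = 1 \<and> d \<ge> 2 \<or> c = 0 \<and> d = 1 \<or> c = 0 \<and> d \<ge> 4" using eq by presburger
        then show thesis using * by (metis le_add_diff_inverse)
      qed
      then show ?thesis
      proof cases
        case 1
        have "c' mod 3 = d mod 3" using eq unfolding 1 by presburger
        then have "optimal_packable (9 * (3 ^ c' * m)) (1 * (3 ^ d * n))"
          using optimal_packable_step[OF rel_packable_9 D[OF _ c pos]] IH[of c' d] pos by (simp add: 1)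
        then show ?thesis by (simp add: 1 power_add mult.assoc)
      next
        case 2
        have "0 mod 3 = d' mod 3" using eq unfolding 2 by presburger
        then have "optimal_packable (3 * (3 ^ 0 * m)) (9 * (3 ^ d' * n))"
          using optimal_packable_step[OF rel_packable_3_9 D[OF _ c pos, of 0 d']] IH[of 0 "Suc d'"] pos
          by (simp add: 2 mult.assoc)
        then show ?thesis by (simp add: 2 power_add mult.assoc)
      next
        case 3
        have "optimal_packable (3 * n) m"
          using optimal_packable_coprime_6[of n m 3] c pos by (simp add: mult.commute)
        then show ?thesis using optimal_packable_swap by (simp add: 3)
      next
        case 4
        \<comment> \<open>After a step over \<open>Z_9\<close> the kernel would have an exponent
          congruent to 2 modulo 3; after \<open>Z_81\<close> it is divisible by 3.\<close>
        have "0 mod 3 = d' mod 3" using eq unfolding 4 by presburger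
        then have "optimal_packable (1 * (3 ^ 0 * m)) (81 * (3 ^ d' * n))"
          using optimal_packable_step[OF rel_packable_swap[OF rel_packable_81] D[OF _ c pos, of 0 d']]
            IH[of 0 d'] pos by (simp add: 4)
        then show ?thesis by (simp add: 4 power_add mult.assoc)
      qed
    qed
  qed
  show ?case
  proof (cases "a mod 3 = b mod 3 \<or> a mod 3 = (b + 2) mod 3")
    case True
    then show ?thesis using main[of a b m n] less.prems by simp
  next
    case False
    \<comment> \<open>The remaining residue of a - b is 1, and exchanging the two factors turns it
      into 2.\<close>
    have "a mod 3 = 0 \<or> a mod 3 = 1 \<or> a mod 3 = 2" "b mod 3 = 0 \<or> b mod 3 = 1 \<or> b mod 3 = 2" by linarith+
    moreover have "(b + 2) mod 3 = (b mod 3 + 2) mod 3" "(a + 2) mod 3 = (a mod 3 + 2) mod 3"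
      by (simp_all only: mod_add_left_eq)
    ultimately have "b mod 3 = (a + 2) mod 3" using False by auto
    then have "optimal_packable (3 ^ b * n) (3 ^ a * m)"
      using main[of b a n m] less.prems by (simp add: mult.commute add.commute)
    then show ?thesis by (rule optimal_packable_swap)
  qed
qed

lemma optimal_packable_odd:
  assumes "odd u" and "odd v"
  shows "optimal_packable u v"
proof -
  have dec: "\<exists>a m. u = 3 ^ a * m \<and> m > 0 \<and> coprime m 6" if "odd u" for u :: nat
  proof -
    have "u \<noteq> 0" using that by (cases u) auto
    then obtain m where m: "u = 3 ^ multiplicity 3 u * m" "\<not> 3 dvd m"
      by (rule multiplicity_decompose'[of u 3]) auto
    have "odd m" using m(1) that by (metis even_mult_iff)
    then have "coprime m 2" "coprime m 3"
      using m(2) prime_imp_coprime[of 3 m] by (auto simp: coprime_commute)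
    then have "coprime m (2 * 3)" by (simp only: coprime_mult_right_iff)
    moreover have "m > 0" using m(2) by (cases m) auto
    ultimately show ?thesis using m(1) by auto
  qed
  obtain a m where "u = 3 ^ a * m" "m > 0" "coprime m 6" using dec[OF assms(1)] by blast
  moreover obtain b n where "v = 3 ^ b * n" "n > 0" "coprime n 6" using dec[OF assms(2)] by blast
  ultimately show ?thesis using optimal_packable_3_powers[of m n a b] by (simp add: coprime_mult_left_iff)
qed

section \<open>From representatives to difference packings of groups\<close>

abbreviation target_group :: "nat \<Rightarrow> nat \<Rightarrow> (int \<times> int) monoid" where
  "target_group u v \<equiv> integer_mod_group (4 * u) \<times>\<times> integer_mod_group (8 * v)"

lemma group_target: "group (target_group u v)"
  by (simp add: DirProd_group)

lemma target_diff:
  assumes "u > 0" "v > 0" "x \<in> carrier (target_group u v)" "y \<in> carrier (target_group u v)"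
  shows "x \<otimes>\<^bsub>target_group u v\<^esub> inv\<^bsub>target_group u v\<^esub> y =
    ((fst x - fst y) mod int (4 * u), (snd x - snd y) mod int (8 * v))"
proof -
  obtain x1 x2 y1 y2 where xy: "x = (x1, x2)" "y = (y1, y2)" by (cases x; cases y)
  have "y1 \<in> carrier (integer_mod_group (4 * u))" "y2 \<in> carrier (integer_mod_group (8 * v))"
    using assms(4) by (simp_all add: xy)
  then have "inv\<^bsub>target_group u v\<^esub> y = ((- y1) mod int (4 * u), (- y2) mod int (8 * v))"
    by (simp add: xy inv_DirProd del: of_nat_mult)
  then show ?thesis by (simp add: xy mod_add_right_eq del: of_nat_mult)
qed

text \<open>The identity and the involutions number between 1 and 4, and removing so few from 32 u v
  elements lowers the quotient by 32 exactly by one.\<close>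

lemma card_target_noninvolutions:
  assumes "u > 0" "v > 0"
  shows "card (carrier (target_group u v) - one_or_involution (target_group u v)) div 32 = u * v - 1"
proof -
  let ?G = "target_group u v" and ?I = "one_or_involution (target_group u v)"
  have car: "carrier ?G = {0..<int (4 * u)} \<times> {0..<int (8 * v)}"
    using assms by (simp add: carrier_integer_mod_group)
  have half: "x = 0 \<or> x = m" if h: "0 \<le> x" "x < 2 * m" "(x + x) mod (2 * m) = 0" for x m :: int
  proof -
    obtain k where k: "x + x = 2 * m * k" using h(3) by (auto elim: dvdE simp: mod_eq_0_iff_dvd)
    then have x: "x = m * k" by simp
    have m: "m > 0" using h(1,2) by linarith
    have "k \<ge> 0" "k < 2" using h(1,2) m unfolding x by (simp_all add: zero_le_mult_iff)
    then have "k = 0 \<or> k = 1" by auto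
    then show ?thesis using x by auto
  qed
  have "?I \<subseteq> {0, 2 * int u} \<times> {0, 4 * int v}"
  proof
    fix z assume z: "z \<in> ?I"
    obtain x y where xy: "z = (x, y)" by (cases z)
    have "z \<in> carrier ?G" "z \<otimes>\<^bsub>?G\<^esub> z = (0, 0)"
      using z assms by (auto simp: one_or_involution_def carrier_integer_mod_group)
    then have r: "0 \<le> x" "x < 2 * (2 * int u)" "(x + x) mod (2 * (2 * int u)) = 0"
      "0 \<le> y" "y < 2 * (4 * int v)" "(y + y) mod (2 * (4 * int v)) = 0"
      using assms by (simp_all add: xy carrier_integer_mod_group)
    show "z \<in> {0, 2 * int u} \<times> {0, 4 * int v}" using half[OF r(1-3)] half[OF r(4-6)] unfolding xy by blast
  qed
  then have "card ?I \<le> card ({0, 2 * int u} \<times> {0, 4 * int v})" by (intro card_mono) auto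
  also have "\<dots> \<le> 4" by (simp add: card_cartesian_product card_insert_if)
  finally have le: "card ?I \<le> 4" .
  have sub: "?I \<subseteq> carrier ?G"
    using assms by (auto simp: one_or_involution_def carrier_integer_mod_group)
  then have fin: "finite ?I" by (rule finite_subset) (simp only: car, simp)
  have "?I \<noteq> {}" by (simp add: one_or_involution_def)
  then have ge: "card ?I \<ge> 1" using fin by (simp add: Suc_le_eq card_gt_0_iff)
  have "card (carrier ?G) = 32 * (u * v)" unfolding car by (simp add: card_cartesian_product nat_mult_distrib)
  then have "card (carrier ?G - ?I) = 32 * (u * v) - card ?I"
    using card_Diff_subset[OF fin sub] by simp
  then show ?thesis using le ge assms by (cases "u * v") auto
qed

text \<open>Equal differences in the group lift to differences of representatives that are congruent
  modulo the lattice, so uniqueness of positions passes from lists to sets of residues.\<close>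

lemma optimal_bdp_if_optimal_packable:
  assumes O: "optimal_packable u v" and odd: "odd u" "odd v"
  shows "\<exists>\<B>. optimal_balanced_difference_packing (target_group u v) {4, 5} \<B>"
proof -
  let ?G = "target_group u v"
  let ?L = "modlat 4 8 \<times> modlat u v"
  have pos: "u > 0" "v > 0" using odd by (auto intro: Nat.gr0I)
  obtain F where F: "packs ?L UNIV (\<lambda>B. B) F" "card {B \<in> F. length B = 4} = u * v - 1"
    "card {B \<in> F. length B = 5} = u * v - 1"
    using packableE[OF O[unfolded optimal_packable_def]] .
  \<comment> \<open>As u and v are odd, (a, x) to u a + 4 x is an isomorphism from
    \<open>Z_4 x Z_u\<close> to \<open>Z_(4u)\<close>, and (b, y) to v b + 8 y is one from
    \<open>Z_8 x Z_v\<close> to \<open>Z_(8v)\<close>.\<close>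
  define \<psi> :: "point \<Rightarrow> int \<times> int" where
    "\<psi> = (\<lambda>((a, b), (x, y)). ((int u * a + 4 * x) mod int (4 * u), (int v * b + 8 * y) mod int (8 * v)))"
  have car: "\<psi> z \<in> carrier ?G" for z
    using pos by (auto simp: \<psi>_def carrier_integer_mod_group split: prod.splits)
  define \<delta> where "\<delta> = (\<lambda>p q. p \<otimes>\<^bsub>?G\<^esub> inv\<^bsub>?G\<^esub> q)"
  have lift: "(x - y) - (z - w) \<in> ?L" if eq: "\<delta> (\<psi> x) (\<psi> y) = \<delta> (\<psi> z) (\<psi> w)" for x y z w
  proof -
    obtain x1 x2 x3 x4 where x: "x = ((x1, x2), (x3, x4))" by (metis surj_pair)
    obtain y1 y2 y3 y4 where y: "y = ((y1, y2), (y3, y4))" by (metis surj_pair)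
    obtain z1 z2 z3 z4 where z: "z = ((z1, z2), (z3, z4))" by (metis surj_pair)
    obtain w1 w2 w3 w4 where w: "w = ((w1, w2), (w3, w4))" by (metis surj_pair)
    let ?a = "x1 - y1 - (z1 - w1)" and ?b = "x2 - y2 - (z2 - w2)"
      and ?c = "x3 - y3 - (z3 - w3)" and ?d = "x4 - y4 - (z4 - w4)"
    have d: "\<delta> (\<psi> x) (\<psi> y) = ((fst (\<psi> x) - fst (\<psi> y)) mod int (4 * u), (snd (\<psi> x) - snd (\<psi> y)) mod int (8 * v))"
      for x y unfolding \<delta>_def by (rule target_diff[OF pos car car])
    have "int (4 * u) dvd (int u * x1 + 4 * x3 - (int u * y1 + 4 * y3)) - (int u * z1 + 4 * z3 - (int u * w1 + 4 * w3))"
      "int (8 * v) dvd (int v * x2 + 8 * x4 - (int v * y2 + 8 * y4)) - (int v * z2 + 8 * z4 - (int v * w2 + 8 * w4))"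
      using eq unfolding d x y z w by (simp_all add: \<psi>_def mod_diff_eq mod_eq_dvd_iff del: of_nat_mult)
    then have 1: "4 * int u dvd int u * ?a + 4 * ?c" and 2: "8 * int v dvd int v * ?b + 8 * ?d"
      by (simp_all add: algebra_simps)
    have cop: "coprime 4 (int u)" "coprime 8 (int v)"
      using odd coprime_power_left_iff[of 2 2 "int u"] coprime_power_left_iff[of 2 3 "int v"]
      by (simp_all add: coprime_commute)
    have "4 dvd int u * ?a + 4 * ?c" "int u dvd int u * ?a + 4 * ?c"
      using 1 by (auto dest: dvd_mult_left dvd_mult_right)
    then have "4 dvd int u * ?a" "int u dvd 4 * ?c"
      by (simp_all only: dvd_add_left_iff dvd_add_right_iff dvd_triv_left)
    then have ac: "4 dvd ?a" "int u dvd ?c"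
      using cop(1) by (simp_all only: coprime_dvd_mult_right_iff coprime_commute)
    have "8 dvd int v * ?b + 8 * ?d" "int v dvd int v * ?b + 8 * ?d"
      using 2 by (auto dest: dvd_mult_left dvd_mult_right)
    then have "8 dvd int v * ?b" "int v dvd 8 * ?d"
      by (simp_all only: dvd_add_left_iff dvd_add_right_iff dvd_triv_left)
    then have bd: "8 dvd ?b" "int v dvd ?d"
      using cop(2) by (simp_all only: coprime_dvd_mult_right_iff coprime_commute)
    show ?thesis using ac bd by (simp add: x y z w)
  qed
  have same: "B = C \<and> i = k \<and> j = l"
    if "B \<in> F" "C \<in> F" "i < length B" "j < length B" "i \<noteq> j" "k < length C" "l < length C" "k \<noteq> l"
      "\<delta> (\<psi> (B ! i)) (\<psi> (B ! j)) = \<delta> (\<psi> (C ! k)) (\<psi> (C ! l))" for B C i j k l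
    by (rule packs_diff_inj[OF F(1) that(1-8) lift[OF that(9)]])
  define \<beta> where "\<beta> = (\<lambda>B. \<psi> ` set B)"
  have inj: "inj_on \<psi> (set B)" and dist: "distinct B" if B: "B \<in> F" for B
  proof -
    have ne: "\<psi> (B ! i) \<noteq> \<psi> (B ! j)" if ij: "i < length B" "j < length B" "i \<noteq> j" for i j
    proof
      assume "\<psi> (B ! i) = \<psi> (B ! j)"
      \<comment> \<open>If two points coincided, a pair and its reverse would have the same
        difference.\<close>
      then have "\<delta> (\<psi> (B ! i)) (\<psi> (B ! j)) = \<delta> (\<psi> (B ! j)) (\<psi> (B ! i))" by simp
      from same[OF B B ij ij(2,1) ij(3)[symmetric] this] ij(3) show False by blast
    qed
    show "distinct B" using ne unfolding distinct_conv_nth by metis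
    show "inj_on \<psi> (set B)" by (rule inj_onI) (metis in_set_conv_nth ne)
  qed
  have card\<beta>: "card (\<beta> B) = length B" if "B \<in> F" for B
    using card_image[OF inj[OF that]] distinct_card[OF dist[OF that]] by (simp add: \<beta>_def)
  have pair: "\<exists>i j. i < length B \<and> j < length B \<and> i \<noteq> j \<and> p = \<psi> (B ! i) \<and> q = \<psi> (B ! j)"
    if "p \<in> \<beta> B" "q \<in> \<beta> B" "p \<noteq> q" for B p q
  proof -
    obtain x y where "p = \<psi> x" "x \<in> set B" "q = \<psi> y" "y \<in> set B" using \<open>p \<in> \<beta> B\<close> \<open>q \<in> \<beta> B\<close> unfolding \<beta>_def by blast
    moreover from this obtain i j where "i < length B" "x = B ! i" "j < length B" "y = B ! j"
      unfolding in_set_conv_nth by blast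
    ultimately show ?thesis using \<open>p \<noteq> q\<close> by blast
  qed
  have \<beta>same: "B = C \<and> p = p' \<and> q = q'"
    if BC: "B \<in> F" "C \<in> F" and pq: "p \<in> \<beta> B" "q \<in> \<beta> B" "p \<noteq> q"
      and pq': "p' \<in> \<beta> C" "q' \<in> \<beta> C" "p' \<noteq> q'" and eq: "\<delta> p q = \<delta> p' q'" for B C p q p' q'
  proof -
    obtain i j where ij: "i < length B" "j < length B" "i \<noteq> j" "p = \<psi> (B ! i)" "q = \<psi> (B ! j)"
      using pair[OF pq] by blast
    obtain k l where kl: "k < length C" "l < length C" "k \<noteq> l" "p' = \<psi> (C ! k)" "q' = \<psi> (C ! l)"
      using pair[OF pq'] by blast
    have "B = C \<and> i = k \<and> j = l" using same[OF BC ij(1-3) kl(1-3)] eq unfolding ij kl .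
    then show ?thesis unfolding ij kl by blast
  qed
  have inj\<beta>: "inj_on \<beta> F"
  proof (rule inj_onI)
    fix B C assume BC: "B \<in> F" "C \<in> F" "\<beta> B = \<beta> C"
    have "card (\<beta> B) \<in> {4, 5}" using card\<beta>[OF BC(1)] packs_length[OF F(1) BC(1)] by simp
    then have "\<not> (\<exists>p. \<beta> B \<subseteq> {p})" using card_mono[of "{_}" "\<beta> B"] by fastforce
    then obtain p q where pq: "p \<in> \<beta> B" "q \<in> \<beta> B" "p \<noteq> q" by blast
    show "B = C" using \<beta>same[OF BC(1,2) pq pq[unfolded BC(3)] refl] by blast
  qed
  define \<B> where "\<B> = \<beta> ` F"
  have finB: "finite \<B>" unfolding \<B>_def using packs_finite[OF F(1)] by (rule finite_imageI)
  have cnt: "card {b \<in> \<B>. card b = k} = u * v - 1" if "k \<in> {4, 5}" for k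
  proof -
    have "{b \<in> \<B>. card b = k} = \<beta> ` {B \<in> F. length B = k}" using card\<beta> unfolding \<B>_def by auto
    then have "card {b \<in> \<B>. card b = k} = card {B \<in> F. length B = k}"
      by (simp add: card_image inj_on_subset[OF inj\<beta>])
    then show ?thesis using that F(2,3) by auto
  qed
  have fin\<beta>: "finite b" if "b \<in> \<B>" for b using that by (auto simp: \<B>_def \<beta>_def)
  have one: "count (\<Sum>b\<in>\<B>. differences ?G b) g \<le> 1" for g
  proof -
    \<comment> \<open>The multiplicity of g is the total number of pairs with difference g in all
      blocks; these pairs, tagged by their blocks, form a set with at most one element.\<close>
    define P where "P = (\<lambda>b. {(x, y). x \<in> b \<and> y \<in> b \<and> x \<noteq> y \<and> \<delta> x y = g})"
    have sub: "{(x, y). x \<in> b \<and> y \<in> b \<and> x \<noteq> y} \<subseteq> b \<times> b" for b by blast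
    have finP: "finite (P b)" if "b \<in> \<B>" for b
      by (rule finite_subset[of _ "b \<times> b"]) (use fin\<beta>[OF that] in \<open>auto simp: P_def\<close>)
    have "count (differences ?G b) g = card (P b)" if "b \<in> \<B>" for b
    proof -
      let ?A = "{(x, y). x \<in> b \<and> y \<in> b \<and> x \<noteq> y}"
      have f: "finite ?A" by (rule finite_subset[OF sub]) (simp add: fin\<beta>[OF that])
      have "count (differences ?G b) g = (\<Sum>z \<in> (\<lambda>(x, y). \<delta> x y) -` {g} \<inter> ?A. count (mset_set ?A) z)"
        unfolding differences_def \<delta>_def count_image_mset finite_set_mset_mset_set[OF f] ..
      also have "\<dots> = (\<Sum>z \<in> (\<lambda>(x, y). \<delta> x y) -` {g} \<inter> ?A. 1)"
        by (rule sum.cong[OF refl]) (simp only: Int_iff count_mset_set(1)[OF f])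
      also have "\<dots> = card ((\<lambda>(x, y). \<delta> x y) -` {g} \<inter> ?A)" by (simp only: card_eq_sum)
      also have "(\<lambda>(x, y). \<delta> x y) -` {g} \<inter> ?A = P b"
        by (auto simp: P_def)
      finally show ?thesis .
    qed
    then have "count (\<Sum>b\<in>\<B>. differences ?G b) g = (\<Sum>b\<in>\<B>. card (P b))" by (simp add: count_sum)
    also have "\<dots> = card (SIGMA b:\<B>. P b)" using finB finP by (simp add: card_SigmaI)
    also have "\<dots> \<le> 1"
    proof -
      have "s = t" if st: "s \<in> (SIGMA b:\<B>. P b)" "t \<in> (SIGMA b:\<B>. P b)" for s t
      proof -
        obtain B p q where s: "s = (\<beta> B, (p, q))" "B \<in> F" "p \<in> \<beta> B" "q \<in> \<beta> B" "p \<noteq> q" "\<delta> p q = g"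
        proof -
          obtain b x y where b: "s = (b, (x, y))" "b \<in> \<B>" "(x, y) \<in> P b" using st(1) by (cases s) auto
          obtain D where "D \<in> F" "b = \<beta> D" using b(2) unfolding \<B>_def by blast
          then show thesis using b by (intro that[of D x y]) (simp_all add: P_def)
        qed
        obtain C p' q' where t: "t = (\<beta> C, (p', q'))" "C \<in> F" "p' \<in> \<beta> C" "q' \<in> \<beta> C" "p' \<noteq> q'" "\<delta> p' q' = g"
        proof -
          obtain b x y where b: "t = (b, (x, y))" "b \<in> \<B>" "(x, y) \<in> P b" using st(2) by (cases t) auto
          obtain D where "D \<in> F" "b = \<beta> D" using b(2) unfolding \<B>_def by blast
          then show thesis using b by (intro that[of D x y]) (simp_all add: P_def)
        qed
        have "\<delta> p q = \<delta> p' q'" using s(6) t(6) by simp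
        from \<beta>same[OF s(2) t(2) s(3-5) t(3-5) this] show ?thesis unfolding s(1) t(1) by blast
      qed
      moreover have "finite (SIGMA b:\<B>. P b)" using finB finP by (rule finite_SigmaI)
      ultimately show ?thesis by (simp add: card_le_Suc0_iff_eq)
    qed
    finally show ?thesis .
  qed
  interpret group ?G by (rule group_target)
  have "optimal_balanced_difference_packing ?G {4, 5} \<B>"
  proof unfold_locales
    show "finite (carrier ?G)" using pos by (simp add: carrier_integer_mod_group)
  next
    fix b assume "b \<in> \<B>"
    then obtain B where B: "B \<in> F" "b = \<beta> B" unfolding \<B>_def by blast
    show "b \<subseteq> carrier ?G" using car unfolding B(2) \<beta>_def by blast
    show "card b \<in> {4, 5}" unfolding B(2) card\<beta>[OF B(1)] by (rule packs_length[OF F(1) B(1)])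
  next
    fix k l :: nat assume "k \<in> {4, 5}" "l \<in> {4, 5}"
    then show "card {b \<in> \<B>. card b = k} = card {b \<in> \<B>. card b = l}" using cnt by simp
  next
    fix k :: nat assume "k \<in> {4, 5}"
    moreover have "(\<Sum>l\<in>{4, 5 :: nat}. l\<^sup>2 - l) = 32" by simp
    ultimately show "card {b \<in> \<B>. card b = k} =
        card (carrier ?G - one_or_involution ?G) div (\<Sum>l\<in>{4, 5}. l\<^sup>2 - l)"
      using cnt card_target_noninvolutions[OF pos] by simp
  qed (use one in auto)
  then show ?thesis by blast
qed

theorem theorem1p1:
  fixes u v :: nat
  assumes "u > 1" and "odd u" and "v > 1" and "odd v"
  shows "\<exists>\<B>. optimal_balanced_difference_packing
           (integer_mod_group (4 * u) \<times>\<times> integer_mod_group (8 * v)) {4, 5} \<B>"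
  using optimal_bdp_if_optimal_packable[OF optimal_packable_odd] assms by blast

end
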